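(* Let $\mathcal{A}\in\mathbb{Z}_{\geq 0}^{(n+1)\times N}$ be as in the context, let $z\in\mathbb{C}^N$ with $\operatorname{Re} z_j>0$ for all $j$, and set $r:=N-n-1$. Let $\sigma\subset\{1,\ldots,N\}$ be an index set with $|\sigma|=n+1$ such that $\det\mathcal{A}_\sigma\neq 0$, and let $\bar\sigma=\{1,\ldots,N\}\setminus\sigma$. Let ${\underline{\nu}}=(\nu_0,\nu)\in\mathbb{C}^{n+1}$ with $\operatorname{Re}\nu_0>0$ and suppose there is $c\in\mathbb{R}^r_{>0}$ such that every component of $\mathcal{A}_\sigma^{-1}\operatorname{Re}{\underline{\nu}}-\mathcal{A}_\sigma^{-1}\mathcal{A}_{\bar\sigma}c$ is strictly positive, and that the integral below converges absolutely along $\gamma=c+i\mathbb{R}^r$. Then $$J_\mathcal{A}({\underline{\nu}},z)=\frac{z_\sigma^{-\mathcal{A}_\sigma^{-1}{\underline{\nu}}}}{|\det\mathcal{A}_\sigma|}\int_\gamma\frac{dt}{(2\pi i)^r}\,\Gamma(t)\,\Gamma\!\left(\mathcal{A}_\sigma^{-1}{\underline{\nu}}-\mathcal{A}_\sigma^{-1}\mathcal{A}_{\bar\sigma}t\right)\,z_{\bar\sigma}^{-t}\,z_\sigma^{\mathcal{A}_\sigma^{-1}\mathcal{A}_{\bar\sigma}t}.$$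
   Context: Fix integers $n\ge1$, $N\ge n+1$ and pairwise distinct column vectors $\mathrm{a}_1,\ldots,\mathrm{a}_N\in\mathbb{Z}_{\geq0}^n$; write $\mathcal{A}\in\mathbb{Z}_{\ge0}^{(n+1)\times N}$ for the matrix whose $j$-th column is $(1,\mathrm{a}_j)$ (first row all ones). For $z\in\mathbb{C}^N$ put $G_z(x)=\sum_{j=1}^N z_j x^{\mathrm{a}_j}$, $x\in\mathbb{R}^n_{>0}$. The generalized Feynman integral is (the meromorphic continuation in ${\underline{\nu}}=(\nu_0,\nu)\in\mathbb{C}\times\mathbb{C}^n$ of) $J_\mathcal{A}({\underline{\nu}},z)=\Gamma(\nu_0)\int_{\mathbb{R}^n_{>0}}x^{\nu-1}G_z(x)^{-\nu_0}\,dx$. Multi-index notation: $x^{\nu-1}=\prod_i x_i^{\nu_i-1}$, $\Gamma(v)=\prod_i\Gamma(v_i)$, $w^{u}=\prod_i w_i^{u_i}$ (principal branches), $dt=dt_1\cdots dt_r$. For an index set $\sigma$, $\mathcal{A}_\sigma$ is the submatrix of columns indexed by $\sigma$, $z_\sigma=(z_i)_{i\in\sigma}$, and similarly for $\bar\sigma$. *)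

theory Defs
  imports "HOL-Analysis.Analysis" "Jordan_Normal_Form.Gauss_Jordan_Elimination"
    "Jordan_Normal_Form.Determinant"
begin

(* Conventions: indices are 0-based.  Columns of the paper's matrix script-A are indexed by
   j \<in> {..<N}; the exponent vector a_j \<in> Z_{\<ge>0}^n is  (\<lambda>i. a j i)  for i < n.
   Rows of script-A are indexed by {0..n}: row 0 is all ones, row i+1 is the i-th coordinate
   of the a_j. *)

definition colA :: "(nat \<Rightarrow> nat \<Rightarrow> nat) \<Rightarrow> nat \<Rightarrow> nat \<Rightarrow> complex" where
  "colA a j i = (if i = 0 then 1 else of_nat (a j (i - 1)))"

definition nuvec :: "complex \<Rightarrow> (nat \<Rightarrow> complex) \<Rightarrow> nat \<Rightarrow> complex" where
  "nuvec nu0 nu i = (if i = 0 then nu0 else nu (i - 1))"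

definition sub_mat :: "nat \<Rightarrow> (nat \<Rightarrow> nat \<Rightarrow> nat) \<Rightarrow> nat set \<Rightarrow> complex mat" where
  "sub_mat n a \<sigma> = Matrix.mat (n + 1) (card \<sigma>) (\<lambda>(i, l). colA a (sorted_list_of_set \<sigma> ! l) i)"

(* A_sigma^{-1} v, for v indexed by rows {0..n}; the result is indexed by sigma
   (entry j \<in> sigma sits at position card {k\<in>sigma. k<j} of the sorted list), 0 outside sigma *)
definition sub_inv_apply ::
  "nat \<Rightarrow> (nat \<Rightarrow> nat \<Rightarrow> nat) \<Rightarrow> nat set \<Rightarrow> (nat \<Rightarrow> complex) \<Rightarrow> nat \<Rightarrow> complex" where
  "sub_inv_apply n a \<sigma> v = (\<lambda>j. if j \<in> \<sigma> then
      Matrix.vec_index (Matrix.mult_mat_vec (the (mat_inverse (sub_mat n a \<sigma>))) (Matrix.vec (n + 1) v))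
        (card {k \<in> \<sigma>. k < j})
    else 0)"

definition cols_apply :: "(nat \<Rightarrow> nat \<Rightarrow> nat) \<Rightarrow> nat set \<Rightarrow> (nat \<Rightarrow> complex) \<Rightarrow> nat \<Rightarrow> complex" where
  "cols_apply a S t = (\<lambda>i. \<Sum>k\<in>S. colA a k i * t k)"

definition Gpoly :: "nat \<Rightarrow> nat \<Rightarrow> (nat \<Rightarrow> nat \<Rightarrow> nat) \<Rightarrow> (nat \<Rightarrow> complex) \<Rightarrow> (nat \<Rightarrow> real) \<Rightarrow> complex" where
  "Gpoly n N a z x = (\<Sum>j<N. z j * (\<Prod>i<n. complex_of_real (x i) ^ a j i))"

definition feynJ :: "nat \<Rightarrow> nat \<Rightarrow> (nat \<Rightarrow> nat \<Rightarrow> nat) \<Rightarrow> complex \<Rightarrow> (nat \<Rightarrow> complex)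
    \<Rightarrow> (nat \<Rightarrow> complex) \<Rightarrow> complex" where
  "feynJ n N a nu0 nu z = Gamma nu0 *
     (LINT x : {x. \<forall>i<n. 0 < x i} | PiM {..<n} (\<lambda>_. lborel).
        (\<Prod>i<n. complex_of_real (x i) powr (nu i - 1)) * Gpoly n N a z x powr (- nu0))"

definition MB_integrand :: "nat \<Rightarrow> nat \<Rightarrow> (nat \<Rightarrow> nat \<Rightarrow> nat) \<Rightarrow> nat set \<Rightarrow> complex \<Rightarrow> (nat \<Rightarrow> complex)
    \<Rightarrow> (nat \<Rightarrow> complex) \<Rightarrow> (nat \<Rightarrow> complex) \<Rightarrow> complex" where
  "MB_integrand n N a \<sigma> nu0 nu z t =
     (let sb = {..<N} - \<sigma>;
          w = sub_inv_apply n a \<sigma> (nuvec nu0 nu);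
          u = sub_inv_apply n a \<sigma> (cols_apply a sb t)
      in (\<Prod>k\<in>sb. Gamma (t k)) * (\<Prod>j\<in>\<sigma>. Gamma (w j - u j))
         * (\<Prod>k\<in>sb. z k powr (- t k)) * (\<Prod>j\<in>\<sigma>. z j powr (u j)))"

end

theory Submission
  imports Defs "HOL-Probability.Probability" "HOL-Complex_Analysis.Complex_Analysis"
begin

text \<open>
  In logarithmic coordinates \<open>x = exp \<xi>\<close>, and after writing \<open>\<Gamma>(\<nu>\<^sub>0) G powr (- \<nu>\<^sub>0)\<close> as a Mellin integral,
  the Feynman integral becomes \<open>\<integral> exp \<langle>\<nu>, \<zeta>\<rangle> \<Prod>\<^sub>j exp (- z\<^sub>j exp \<langle>A\<^sub>j, \<zeta>\<rangle>) d\<zeta>\<close> over the space of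
  dimension \<open>n + 1\<close>. Each factor with \<open>j \<notin> \<sigma>\<close> is replaced by its Mellin-Barnes representation, the order of
  integration is exchanged, and the linear substitution \<open>\<eta>\<^sub>l = \<langle>A\<^sub>l, \<zeta>\<rangle>\<close>, \<open>l \<in> \<sigma>\<close>, splits the inner integral
  into one-dimensional Mellin integrals. The modulus of the joint integrand is a product of a function of \<open>\<zeta>\<close>
  and a function of the contour variables, which makes Fubini immediate.
\<close>

section \<open>The Mellin integral of the exponential\<close>

text \<open>Adjoining the Mellin variable of \<open>nu0\<close> turns the sum \<open>G\<close> into
  a product with one factor per monomial. The row of ones treats the new variable like the others,
  so any \<open>n + 1\<close> linearly independent columns can serve as coordinates, and
  \<open>|det|\<close> in the denominator is the Jacobian of that choice. The modulus of the joint
  integrand splits because the submatrix for \<sigma> is real: moving along the contour changes the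
  exponents of the inner Mellin integrals only in their imaginary parts, and the condition on
  \<open>c\<close> says that their constant real parts are positive. The analytic obstacle is
  integrability along the contour. On a vertical line \<open>z powr (- t)\<close> may grow like
  \<open>exp (|arg z| |Im t|)\<close>; \<open>Re z > 0\<close> keeps \<open>|arg z|\<close> below
  \<open>pi / 2\<close>, and \<open>Gamma\<close> decays at every exponential rate below
  \<open>pi / 2\<close>. This decay is read off from the Mellin integral of
  \<open>exp (- z v)\<close> for complex \<open>z\<close>, and the Mellin-Barnes formula then
  follows by Fourier inversion, so no asymptotic expansion of \<open>Gamma\<close>, contour shift or
  residue enters.\<close>

lemma distr_exp_lborel:
  "distr (density lborel (\<lambda>y. ennreal (exp y))) borel exp = density lborel (indicator {0<..} :: real \<Rightarrow> ennreal)"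
proof (rule measure_eqI)
  fix A :: "real set"
  assume "A \<in> sets (distr (density lborel (\<lambda>y. ennreal (exp y))) borel exp)"
  then have A [measurable]: "A \<in> sets borel" by simp
  have A': "exp -` A \<in> sets (borel :: real measure)"
    using measurable_sets[of exp borel borel A] by simp
  \<comment> \<open>The substitution rule applies on compact intervals, so the half-line is
    exhausted by the images of \<open>[-k, k]\<close> and both sides converge monotonically.\<close>
  have eq: "(\<integral>\<^sup>+ x. ennreal (indicator A x * indicator {exp (- real k)..exp (real k)} x) \<partial>lborel) =
      (\<integral>\<^sup>+ x. ennreal (indicator A (exp x) * exp x * indicator {- real k..real k} x) \<partial>lborel)" for k
    by (rule nn_integral_substitution)
       (auto intro!: DERIV_exp continuous_intros simp: set_borel_measurable_def)
  have l1: "(\<lambda>k. \<integral>\<^sup>+ x. ennreal (indicator A x * indicator {exp (- real k)..exp (real k)} x) \<partial>lborel)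
      \<longlonglongrightarrow> (\<integral>\<^sup>+ x. ennreal (indicator A x * indicator {0<..} x) \<partial>lborel)"
  proof (rule nn_integral_LIMSEQ)
    show "incseq (\<lambda>k x. ennreal (indicator A x * indicator {exp (- real k)..exp (real k)} x))"
    proof (rule incseq_SucI, rule le_funI, rule ennreal_leI)
      fix k x
      have sub: "{exp (- real k)..exp (real k)} \<subseteq> {exp (- real (Suc k))..exp (real (Suc k))}"
        by auto
      then show "indicator A x * indicator {exp (- real k)..exp (real k)} x
          \<le> (indicator A x * indicator {exp (- real (Suc k))..exp (real (Suc k))} x :: real)"
        using subsetD[OF sub, of x] by (simp add: indicator_def del: of_nat_Suc atLeastAtMost_iff)
    qed
    fix x :: real
    have "\<forall>\<^sub>F k in sequentially. ennreal (indicator A x * indicator {exp (- real k)..exp (real k)} x)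
        = ennreal (indicator A x * indicator {0<..} x)"
    proof (cases "x > 0")
      case True
      obtain K where K: "real K \<ge> \<bar>ln x\<bar>" using real_arch_simple by blast
      show ?thesis
      proof (rule eventually_sequentiallyI[of K])
        fix k assume "K \<le> k"
        with K have "- real k \<le> ln x" "ln x \<le> real k" by linarith+
        then have "exp (- real k) \<le> x" "x \<le> exp (real k)"
          using True by (metis exp_le_cancel_iff exp_ln)+
        then show "ennreal (indicator A x * indicator {exp (- real k)..exp (real k)} x)
          = ennreal (indicator A x * indicator {0<..} x)" using True by simp
      qed
    next
      case False
      then have "\<not> exp (- real k) \<le> x" for k
        by (metis exp_gt_zero order_less_le_trans)
      with False show ?thesis by simp
    qed
    then show "(\<lambda>k. ennreal (indicator A x * indicator {exp (- real k)..exp (real k)} x))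
       \<longlonglongrightarrow> ennreal (indicator A x * indicator {0<..} x)"
      by (rule tendsto_eventually)
  qed auto
  have l2: "(\<lambda>k. \<integral>\<^sup>+ x. ennreal (indicator A (exp x) * exp x * indicator {- real k..real k} x) \<partial>lborel)
      \<longlonglongrightarrow> (\<integral>\<^sup>+ x. ennreal (indicator A (exp x) * exp x) \<partial>lborel)"
  proof (rule nn_integral_LIMSEQ)
    show "incseq (\<lambda>k x. ennreal (indicator A (exp x) * exp x * indicator {- real k..real k} x))"
      by (rule incseq_SucI, rule le_funI, rule ennreal_leI) (auto split: split_indicator)
    fix x :: real
    obtain K where K: "real K \<ge> \<bar>x\<bar>" using real_arch_simple by blast
    have "\<forall>\<^sub>F k in sequentially. ennreal (indicator A (exp x) * exp x * indicator {- real k..real k} x)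
        = ennreal (indicator A (exp x) * exp x)"
      by (rule eventually_sequentiallyI[of K]) (use K in \<open>auto simp: indicator_def\<close>)
    then show "(\<lambda>k. ennreal (indicator A (exp x) * exp x * indicator {- real k..real k} x))
       \<longlonglongrightarrow> ennreal (indicator A (exp x) * exp x)"
      by (rule tendsto_eventually)
  qed auto
  have "(\<integral>\<^sup>+ x. ennreal (indicator A x * indicator {0<..} x) \<partial>lborel)
      = (\<integral>\<^sup>+ x. ennreal (indicator A (exp x) * exp x) \<partial>lborel)"
    using LIMSEQ_unique[OF l1[unfolded eq] l2] .
  moreover have "emeasure (distr (density lborel (\<lambda>y. ennreal (exp y))) borel exp) A
      = (\<integral>\<^sup>+ x. ennreal (indicator A (exp x) * exp x) \<partial>lborel)"
    using A' by (subst emeasure_distr) (auto simp: emeasure_density intro!: nn_integral_cong split: split_indicator)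
  moreover have "emeasure (density lborel (indicator {0<..})) A
      = (\<integral>\<^sup>+ x. ennreal (indicator A x * indicator {0<..} x) \<partial>lborel)"
    by (auto simp: emeasure_density intro!: nn_integral_cong split: split_indicator)
  ultimately show "emeasure (distr (density lborel (\<lambda>y. ennreal (exp y))) borel exp) A
      = emeasure (density lborel (indicator {0<..})) A"
    by simp
qed simp

lemma integral_exp_substitution:
  fixes f :: "real \<Rightarrow> 'b::{banach, second_countable_topology}"
  assumes f [measurable]: "f \<in> borel_measurable borel"
  shows "integrable lborel (\<lambda>y. exp y *\<^sub>R f (exp y)) \<longleftrightarrow> integrable lborel (\<lambda>x. indicator {0<..} x *\<^sub>R f x)" (is ?A)
    and "(LINT y|lborel. exp y *\<^sub>R f (exp y)) = (LINT x|lborel. indicator {0<..} x *\<^sub>R f x)" (is ?B)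
proof -
  have d: "density lborel (indicator {0<..} :: real \<Rightarrow> ennreal) = density lborel (\<lambda>x. ennreal (indicator {0<..} x))"
    by (simp add: ennreal_indicator)
  have "integrable lborel (\<lambda>y. exp y *\<^sub>R f (exp y)) \<longleftrightarrow> integrable (density lborel (\<lambda>y. ennreal (exp y))) (\<lambda>y. f (exp y))"
    by (subst integrable_density) auto
  also have "\<dots> \<longleftrightarrow> integrable (distr (density lborel (\<lambda>y. ennreal (exp y))) borel exp) f"
    by (subst integrable_distr_eq) auto
  also have "\<dots> \<longleftrightarrow> integrable lborel (\<lambda>x. indicator {0<..} x *\<^sub>R f x)"
    unfolding distr_exp_lborel d by (subst integrable_density) auto
  finally show ?A .
  have "(LINT y|lborel. exp y *\<^sub>R f (exp y)) = (LINT y|density lborel (\<lambda>y. ennreal (exp y)). f (exp y))"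
    by (subst integral_density) auto
  also have "\<dots> = (LINT x|distr (density lborel (\<lambda>y. ennreal (exp y))) borel exp. f x)"
    by (subst integral_distr) auto
  also have "\<dots> = (LINT x|lborel. indicator {0<..} x *\<^sub>R f x)"
    unfolding distr_exp_lborel d by (subst integral_density) auto
  finally show ?B .
qed

lemma exp_Gamma_integral_1:
  fixes t :: complex
  assumes t: "0 < Re t"
  shows "has_bochner_integral lborel (\<lambda>y. exp (t * of_real y) * exp (- of_real (exp y))) (Gamma t)"
proof -
  \<comment> \<open>Writing the power through the real \<open>ln\<close> makes \<open>f\<close>
    measurable on the whole line, and it agrees with \<open>powr\<close> on the positive axis.
    Euler's integral is available as a gauge integral that is absolutely integrable over
    \<open>lebesgue\<close>; both facts are carried over to \<open>lborel\<close>.\<close>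
  define f where "f = (\<lambda>x. exp ((t - 1) * of_real (ln x)) / complex_of_real (exp x))"
  have f [measurable]: "f \<in> borel_measurable borel" unfolding f_def by measurable
  have fe: "complex_of_real x powr (t - 1) / complex_of_real (exp x) = f x" if "x \<in> {0<..}" for x
    using that by (simp add: f_def powr_def Ln_of_real)
  have "integrable lebesgue (\<lambda>x. indicator {0<..} x *\<^sub>R f x)"
    using absolutely_integrable_Gamma_integral'[OF t] unfolding set_integrable_def
    by (rule Bochner_Integration.integrable_cong[THEN iffD1, rotated 2]) (auto simp: fe indicator_def)
  then have int: "integrable lborel (\<lambda>x. indicator {0<..} x *\<^sub>R f x)"
    by (subst (asm) integrable_completion) auto
  have "(\<lambda>x. indicator {0<..} x *\<^sub>R f x) = (\<lambda>x. if x \<in> {0<..} then f x else 0)"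
    by (auto simp: indicator_def)
  moreover have "(f has_integral Gamma t) {0<..}"
    by (rule has_integral_eq[OF _ Gamma_integral_complex'[OF t]]) (rule fe)
  ultimately have "((\<lambda>x. indicator {0<..} x *\<^sub>R f x) has_integral Gamma t) UNIV"
    by (simp only: has_integral_restrict_UNIV)
  moreover have "((\<lambda>x. indicator {0<..} x *\<^sub>R f x) has_integral (LINT x|lborel. indicator {0<..} x *\<^sub>R f x)) UNIV"
    by (rule has_integral_integral_lborel[OF int])
  ultimately have val: "(LINT x|lborel. indicator {0<..} x *\<^sub>R f x) = Gamma t"
    by (blast intro: has_integral_unique)
  have e: "exp y *\<^sub>R f (exp y) = exp (t * of_real y) * exp (- of_real (exp y))" for y
  proof -
    have "exp ((t - 1) * of_real y) = exp (t * of_real y) / exp (of_real y)"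
      by (simp add: exp_diff[symmetric] ring_distribs)
    then show ?thesis
      by (simp add: f_def exp_minus scaleR_conv_of_real exp_of_real[symmetric] field_simps)
  qed
  show ?thesis
    using int val integral_exp_substitution[OF f] by (simp add: has_bochner_integral_iff e)
qed

lemma exp_Gamma_integral_real:
  fixes t :: complex and z :: real
  assumes t: "0 < Re t" and z: "0 < z"
  shows "has_bochner_integral lborel (\<lambda>y. exp (t * of_real y) * exp (- of_real (z * exp y))) (Gamma t * of_real z powr (- t))"
proof -
  let ?f = "\<lambda>y. exp (t * of_real y) * exp (- complex_of_real (exp y))"
  have "has_bochner_integral lborel (\<lambda>y. ?f (ln z + 1 * y)) (Gamma t)"
    using lborel_has_bochner_integral_real_affine_iff[of 1 ?f "Gamma t" "ln z"] exp_Gamma_integral_1[OF t]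
    by simp
  then have "has_bochner_integral lborel (\<lambda>y. of_real z powr (- t) * ?f (ln z + 1 * y)) (of_real z powr (- t) * Gamma t)"
    by (rule has_bochner_integral_mult_right)
  moreover have "of_real z powr (- t) * ?f (ln z + 1 * y) = exp (t * of_real y) * exp (- of_real (z * exp y))" for y
    using z by (simp add: powr_def Ln_of_real exp_add ring_distribs exp_minus)
  ultimately show ?thesis by (simp add: mult.commute)
qed

text \<open>
  Expanding \<open>exp (- z v)\<close> around a real centre \<open>r\<close> and integrating termwise yields the binomial series
  of \<open>z powr (- t)\<close>; for \<open>Re z > 0\<close> a large enough \<open>r\<close> satisfies \<open>|z - r| < r\<close>.
\<close>

lemma exp_Gamma_integral:
  fixes t z :: complex
  assumes t: "0 < Re t" and z: "0 < Re z"
  shows "has_bochner_integral lborel (\<lambda>y. exp (t * of_real y) * exp (- z * of_real (exp y))) (Gamma t * z powr (- t))"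
proof -
  obtain r :: real where r: "0 < r" "cmod (z - of_real r) < r"
  proof
    \<comment> \<open>\<open>|z - r| < r\<close> amounts to
      \<open>2 * r * Re z > |z|\<^sup>2\<close>; the summand 1 makes the inequality strict.\<close>
    define r where "r = ((cmod z)\<^sup>2 + 1) / (2 * Re z)"
    show r0: "0 < r" unfolding r_def using z by (intro divide_pos_pos) (auto intro: add_nonneg_pos)
    have "(cmod (z - of_real r))\<^sup>2 = (cmod z)\<^sup>2 - 2 * Re z * r + r\<^sup>2"
      unfolding cmod_power2 by (simp add: power2_eq_square algebra_simps)
    also have "\<dots> < r\<^sup>2" using z by (simp add: r_def)
    finally show "cmod (z - of_real r) < r" using r0 by (simp add: power_less_imp_less_base)
  qed
  define w where "w = of_real r - z"
  have w: "cmod w < r" using r by (simp add: w_def norm_minus_commute)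
  \<comment> \<open>Since \<open>Gamma (s + k)\<close> is \<open>Gamma s\<close> times a Pochhammer
    symbol, the integrals of the terms are those of the binomial series of
    \<open>(1 - v / r) powr (- s)\<close>. Both \<open>s\<close> and \<open>v\<close> stay general
    because the series is used twice: at \<open>t\<close>, \<open>w\<close> for the value and at
    \<open>Re t\<close>, \<open>|w|\<close> for domination.\<close>
  have coeff: "v ^ k / fact k * (Gamma (s + of_nat k) * of_real r powr (- (s + of_nat k)))
      = Gamma s * of_real r powr (- s) * ((- s gchoose k) * (- v / of_real r) ^ k)"
    if s: "0 < Re s" for s v :: complex and k
  proof -
    have "s \<notin> \<int>\<^sub>\<le>\<^sub>0" using s by (auto elim!: nonpos_Ints_cases)
    then have "Gamma s \<noteq> 0" "pochhammer s k = Gamma (s + of_nat k) / Gamma s"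
      by (auto simp: Gamma_eq_zero_iff pochhammer_Gamma)
    then have G: "Gamma (s + of_nat k) = Gamma s * pochhammer s k" by simp
    have p: "complex_of_real r powr (- (s + of_nat k)) = of_real r powr (- s) / of_real r ^ k"
      using r by (simp add: powr_diff powr_nat)
    have "(- 1) ^ k * (- v / of_real r) ^ k = v ^ k / complex_of_real r ^ k"
      by (simp add: power_divide flip: power_mult_distrib)
    then have "(- s gchoose k) * (- v / of_real r) ^ k = pochhammer s k / fact k * (v ^ k / of_real r ^ k)"
      unfolding gbinomial_pochhammer by (simp add: mult.left_commute mult.commute)
    then show ?thesis unfolding G p by simp
  qed
  define f where "f = (\<lambda>s v k y. v ^ k / fact k * (exp ((s + of_nat k) * of_real y) * exp (- complex_of_real (r * exp y))))"
  have f_int: "has_bochner_integral lborel (f s v k) (Gamma s * of_real r powr (- s) * ((- s gchoose k) * (- v / of_real r) ^ k))"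
    if s: "0 < Re s" for s v k
    unfolding f_def coeff[OF s, symmetric]
    using s r by (intro has_bochner_integral_mult_right exp_Gamma_integral_real) auto
  have f_sums: "(\<lambda>k. f s v k y) sums (exp (s * of_real y) * exp ((v - of_real r) * of_real (exp y)))" for s v y
  proof -
    have "(\<lambda>k. exp (s * of_real y) * exp (- complex_of_real (r * exp y)) * ((v * of_real (exp y)) ^ k /\<^sub>R fact k))
        sums (exp (s * of_real y) * exp (- complex_of_real (r * exp y)) * exp (v * of_real (exp y)))"
      by (intro sums_mult exp_converges)
    moreover have "exp (s * of_real y) * exp (- complex_of_real (r * exp y)) * ((v * of_real (exp y)) ^ k /\<^sub>R fact k) = f s v k y" for k
      by (simp add: f_def ring_distribs exp_add power_mult_distrib scaleR_conv_of_real exp_of_real exp_of_nat_mult divide_inverse)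
    moreover have "exp (s * of_real y) * exp (- complex_of_real (r * exp y)) * exp (v * of_real (exp y))
        = exp (s * of_real y) * exp ((v - of_real r) * of_real (exp y))"
      by (simp add: exp_diff ring_distribs exp_minus divide_inverse left_diff_distrib)
    ultimately show ?thesis by (simp only:)
  qed
  have Gam_sums: "(\<lambda>k. Gamma s * of_real r powr (- s) * ((- s gchoose k) * (- v / of_real r) ^ k))
     sums (Gamma s * of_real r powr (- s) * (1 + (- v / of_real r)) powr (- s))" if "cmod v < r" for s v
    using that r by (intro sums_mult gen_binomial_complex) (simp add: norm_divide)
  \<comment> \<open>The norms of the terms form the same series with \<open>t\<close> and
    \<open>w\<close> replaced by \<open>Re t\<close> and \<open>|w|\<close>. As
    \<open>|w| < r\<close> still holds, the interchange of sum and integral is justified by the two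
    summations already proved.\<close>
  have norm_f: "complex_of_real (norm (f t w k y)) = f (of_real (Re t)) (of_real (cmod w)) k y" for k y
    unfolding f_def by (simp add: norm_mult norm_divide norm_power exp_of_real[symmetric])
  have sum1: "summable (\<lambda>k. norm (f t w k y))" for y
    using sums_summable[OF f_sums] by (simp flip: summable_complex_of_real add: norm_f)
  have sum2: "summable (\<lambda>k. LINT y|lborel. norm (f t w k y))"
  proof -
    have "complex_of_real (LINT y|lborel. norm (f t w k y)) =
        Gamma (of_real (Re t)) * of_real r powr (- of_real (Re t)) * ((- of_real (Re t) gchoose k) * (- of_real (cmod w) / of_real r) ^ k)" for k
      using has_bochner_integral_integral_eq[OF f_int[of "of_real (Re t)" "of_real (cmod w)" k]] t
      by (simp add: norm_f flip: integral_complex_of_real)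
    then show ?thesis
      using sums_summable[OF Gam_sums[of "of_real (cmod w)" "of_real (Re t)"]] w
      by (simp flip: summable_complex_of_real)
  qed
  have suminf: "(\<Sum>k. f t w k y) = exp (t * of_real y) * exp (- z * of_real (exp y))" for y
    using sums_unique[OF f_sums[of t w y]] by (simp add: w_def)
  have int: "integrable lborel (f t w k)" for k using f_int[OF t] by (simp add: has_bochner_integral_iff)
  have i: "integrable lborel (\<lambda>y. \<Sum>k. f t w k y)"
    by (rule integrable_suminf[OF int]) (use sum1 sum2 in auto)
  have "(\<lambda>k. LINT y|lborel. f t w k y) sums (LINT y|lborel. (\<Sum>k. f t w k y))"
    by (rule sums_integral[OF int]) (use sum1 sum2 in auto)
  moreover have "(\<lambda>k. LINT y|lborel. f t w k y) sums (Gamma t * of_real r powr (- t) * (1 + (- w / of_real r)) powr (- t))"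
    using Gam_sums[OF w, of t] by (simp add: has_bochner_integral_integral_eq[OF f_int[OF t]])
  ultimately have "(LINT y|lborel. (\<Sum>k. f t w k y)) = Gamma t * of_real r powr (- t) * (1 + (- w / of_real r)) powr (- t)"
    by (rule sums_unique2)
  also have "1 + (- w / of_real r) = z / of_real r" using r by (simp add: w_def field_simps)
  also have "Gamma t * of_real r powr (- t) * (z / of_real r) powr (- t) = Gamma t * z powr (- t)"
    using powr_times_real_left[of "of_real r" "z / of_real r" "- t"] r by simp
  finally show ?thesis using i by (simp add: suminf has_bochner_integral_iff)
qed

section \<open>Decay of Gamma on vertical lines\<close>

lemma norm_exp_Gamma_integrand:
  "norm (exp (t * of_real y) * exp (- z * of_real (exp y))) = exp (Re t * y) * exp (- Re z * exp y)" for t z :: complex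
  by (simp add: norm_mult)

text \<open>Rotating the ray of the Gamma integral, that is taking \<open>z = exp (i \<theta>)\<close>, trades \<open>|z powr (- t)|\<close> for exponential decay.\<close>

lemma Gamma_vertical_decay:
  fixes c \<phi> s :: real
  assumes c: "0 < c" and \<phi>: "0 \<le> \<phi>" "\<phi> < pi / 2"
  shows "cmod (Gamma (of_real c + \<i> * of_real s)) \<le> (LINT y|lborel. exp (c * y) * exp (- cos \<phi> * exp y)) * exp (- \<phi> * \<bar>s\<bar>)"
proof -
  \<comment> \<open>The sign follows that of \<open>s\<close>, so the gain is
    \<open>exp (\<phi> * |s|)\<close> in both directions, while \<open>Re z = cos \<phi>\<close> and
    hence the bounding integral do not depend on the sign.\<close>
  define \<theta> where "\<theta> = (if s \<ge> 0 then \<phi> else - \<phi>)"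
  define t where "t = complex_of_real c + \<i> * of_real s"
  define z where "z = exp (\<i> * complex_of_real \<theta>)"
  have Re_z: "Re z = cos \<phi>" by (simp add: z_def \<theta>_def Re_exp)
  have "0 < Re z" unfolding Re_z using \<phi> by (intro cos_gt_zero_pi) auto
  then have G: "has_bochner_integral lborel (\<lambda>y. exp (t * of_real y) * exp (- z * of_real (exp y))) (Gamma t * z powr (- t))"
    using c by (intro exp_Gamma_integral) (auto simp: t_def)
  have "Ln z = \<i> * complex_of_real \<theta>"
    unfolding z_def using \<phi> pi_gt_zero by (intro Ln_exp) (auto simp: \<theta>_def)
  then have "cmod (z powr (- t)) = exp (s * \<theta>)"
    by (simp add: powr_def z_def t_def)
  also have "s * \<theta> = \<phi> * \<bar>s\<bar>" by (auto simp: \<theta>_def)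
  finally have "cmod (Gamma t) * exp (\<phi> * \<bar>s\<bar>) = cmod (Gamma t * z powr (- t))"
    by (simp add: norm_mult)
  also have "\<dots> \<le> (LINT y|lborel. norm (exp (t * of_real y) * exp (- z * of_real (exp y))))"
    unfolding has_bochner_integral_integral_eq[OF G, symmetric] by (rule integral_norm_bound)
  also have "\<dots> = (LINT y|lborel. exp (c * y) * exp (- cos \<phi> * exp y))"
    unfolding norm_exp_Gamma_integrand Re_z by (simp add: t_def)
  finally show ?thesis by (simp add: t_def exp_minus field_simps)
qed

lemma integrable_exp_minus_abs:
  fixes \<delta> :: real
  assumes "0 < \<delta>"
  shows "integrable lborel (\<lambda>s. exp (- \<delta> * \<bar>s\<bar>))"
proof -
  define g where "g = (\<lambda>s. indicator {0..} s *\<^sub>R exp (- \<delta> * s))"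
  have "(\<lambda>s. exp (- \<delta> * s)) absolutely_integrable_on {0..}"
    using integrable_on_exp_minus_to_infinity[OF assms, of 0]
    by (intro nonnegative_absolutely_integrable_1) auto
  then have "integrable lebesgue g" by (simp add: g_def set_integrable_def)
  then have g: "integrable lborel g"
    by (subst (asm) integrable_completion) (auto simp: g_def)
  have "integrable lborel (\<lambda>s. g (0 + (-1) * s))"
    using g by (rule lborel_integrable_real_affine) simp
  from Bochner_Integration.integrable_add[OF g this] show ?thesis
    by (rule Bochner_Integration.integrable_bound) (auto simp: g_def split: split_indicator)
qed

text \<open>The growth rate of \<open>z powr (- t)\<close> is at most
  \<open>|Im (Ln z)| < pi / 2\<close>, so a decay rate \<phi> of \<open>Gamma\<close> fits strictly
  between it and \<open>pi / 2\<close>; the gap \<delta> is the exponential rate that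
  remains.\<close>

lemma Gamma_powr_vertical_integrable:
  fixes c :: real and z :: complex
  assumes c: "0 < c" and z: "0 < Re z"
  defines "t \<equiv> \<lambda>s. complex_of_real c + \<i> * of_real s"
  shows "integrable lborel (\<lambda>s. Gamma (t s) * z powr (- t s))"
proof -
  have z0: "z \<noteq> 0" using z by auto
  have "\<bar>Im (Ln z)\<bar> < pi / 2" using Re_Ln_pos_lt[OF z0] z by blast
  then obtain \<phi> where \<phi>: "\<bar>Im (Ln z)\<bar> < \<phi>" "\<phi> < pi / 2" using dense by blast
  define C where "C = (LINT y|lborel. exp (c * y) * exp (- cos \<phi> * exp y)) * exp (- c * Re (Ln z))"
  define \<delta> where "\<delta> = \<phi> - \<bar>Im (Ln z)\<bar>"
  have \<delta>: "0 < \<delta>" using \<phi> by (simp add: \<delta>_def)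
  have bound: "cmod (Gamma (t s) * z powr (- t s)) \<le> norm (C * exp (- \<delta> * \<bar>s\<bar>))" for s
  proof -
    let ?I = "LINT y|lborel. exp (c * y) * exp (- cos \<phi> * exp y)"
    have I: "0 \<le> ?I" by (intro integral_nonneg_AE) auto
    have "cmod (z powr (- t s)) = exp (- c * Re (Ln z) + s * Im (Ln z))"
      using z0 by (simp add: powr_def t_def algebra_simps)
    moreover have "s * Im (Ln z) \<le> \<bar>Im (Ln z)\<bar> * \<bar>s\<bar>"
      by (metis abs_ge_self abs_mult mult.commute)
    ultimately have "cmod (z powr (- t s)) \<le> exp (- c * Re (Ln z)) * exp (\<bar>Im (Ln z)\<bar> * \<bar>s\<bar>)"
      by (simp flip: exp_add)
    moreover have "cmod (Gamma (t s)) \<le> ?I * exp (- \<phi> * \<bar>s\<bar>)"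
      unfolding t_def using c \<phi> by (intro Gamma_vertical_decay) auto
    ultimately have "cmod (Gamma (t s) * z powr (- t s))
        \<le> (?I * exp (- \<phi> * \<bar>s\<bar>)) * (exp (- c * Re (Ln z)) * exp (\<bar>Im (Ln z)\<bar> * \<bar>s\<bar>))"
      unfolding norm_mult using I by (intro mult_mono) auto
    also have "\<dots> = C * exp (- \<delta> * \<bar>s\<bar>)"
      by (simp add: C_def \<delta>_def left_diff_distrib exp_diff exp_minus field_simps)
    also have "\<dots> \<le> norm (C * exp (- \<delta> * \<bar>s\<bar>))" by simp
    finally show ?thesis .
  qed
  \<comment> \<open>\<open>Gamma\<close> has poles, so its measurability is taken from its entire
    reciprocal.\<close>
  have "rGamma \<in> borel_measurable (borel :: complex measure)"
    by (intro borel_measurable_continuous_onI continuous_intros)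
  then have meas: "(\<lambda>s. Gamma (t s) * z powr (- t s)) \<in> borel_measurable lborel"
    using z0 unfolding Gamma_def t_def powr_def by measurable
  have "integrable lborel (\<lambda>s. C * exp (- \<delta> * \<bar>s\<bar>))"
    using integrable_exp_minus_abs[OF \<delta>] by simp
  then show ?thesis
    by (rule Bochner_Integration.integrable_bound) (use meas bound in auto)
qed

section \<open>Fourier inversion and the Mellin-Barnes integral\<close>

text \<open>This is the characteristic function of the standard normal distribution at
  \<open>u / \<epsilon>\<close>, rescaled by \<open>v = \<epsilon> * s\<close>. It serves as the
  summation kernel for Fourier inversion.\<close>

lemma gaussian_fourier_integral:
  fixes \<epsilon> u :: real
  assumes \<epsilon>: "0 < \<epsilon>"
  shows "(LINT s|lborel. of_real (std_normal_density (\<epsilon> * s)) * exp (\<i> * of_real (s * u)))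
    = of_real (sqrt (2 * pi) / \<epsilon> * std_normal_density (u / \<epsilon>))"
proof -
  have "complex_of_real (exp (- (u / \<epsilon>)\<^sup>2 / 2)) = char std_normal_distribution (u / \<epsilon>)"
    by (simp add: char_std_normal_distribution)
  also have "\<dots> = (LINT v|lborel. std_normal_density v *\<^sub>R exp (\<i> * of_real (u / \<epsilon> * v)))"
    unfolding char_def by (subst integral_density) auto
  also have "\<dots> = \<epsilon> *\<^sub>R (LINT s|lborel. std_normal_density (\<epsilon> * s) *\<^sub>R exp (\<i> * of_real (s * u)))"
    using \<epsilon> by (subst lborel_integral_real_affine[of \<epsilon> _ 0]) (auto simp: mult.commute)
  finally have "(LINT s|lborel. of_real (std_normal_density (\<epsilon> * s)) * exp (\<i> * of_real (s * u)))
     = complex_of_real (exp (- (u / \<epsilon>)\<^sup>2 / 2)) / of_real \<epsilon>"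
    using \<epsilon> by (simp add: scaleR_conv_of_real)
  then show ?thesis by (simp add: std_normal_density_def)
qed

text \<open>A Gaussian weight in \<open>s\<close> makes the double integral absolutely convergent;
  exchanging the order turns it into an average of \<open>f\<close> around \<open>x\<close> of width
  \<epsilon>. As \<epsilon> tends to 0, integrability of \<open>F\<close> dominates the weighted
  side, and boundedness of \<open>f\<close> together with continuity at \<open>x\<close> handles the
  average.\<close>

lemma fourier_inversion:
  fixes f F :: "real \<Rightarrow> complex" and x B :: real
  assumes f: "integrable lborel f" and bound: "\<And>y. cmod (f y) \<le> B" and cont: "isCont f x"
    and F_def: "\<And>s. F s = (LINT y|lborel. f y * exp (\<i> * of_real (s * y)))"
    and F: "integrable lborel F"
  shows "(LINT s|lborel. F s * exp (- \<i> * of_real (s * x))) = of_real (2 * pi) * f x"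
proof -
  let ?g = std_normal_density
  have f_meas [measurable]: "f \<in> borel_measurable borel" using f by simp
  have F_meas [measurable]: "F \<in> borel_measurable borel" using F by simp
  have g_le: "?g v \<le> ?g 0" for v by (simp add: std_normal_density_def divide_right_mono)
  define L where "L = (\<lambda>\<epsilon>. LINT s|lborel. F s * exp (- \<i> * of_real (s * x)) * of_real (?g (\<epsilon> * s)))"
  define R where "R = (\<lambda>\<epsilon>. LINT v|lborel. f (x + \<epsilon> * v) * of_real (?g v))"
  have LR: "L \<epsilon> = of_real (sqrt (2 * pi)) * R \<epsilon>" if \<epsilon>: "0 < \<epsilon>" for \<epsilon>
  proof -
    let ?h = "\<lambda>s y. f y * exp (\<i> * of_real (s * (y - x))) * of_real (?g (\<epsilon> * s))"
    have g_int: "integrable lborel (\<lambda>s. ?g (\<epsilon> * s))"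
      using lborel_integrable_real_affine[of ?g \<epsilon> 0] integrable_std_normal_moment[of 0] \<epsilon> by simp
    have h_norm: "cmod (?h s y) = ?g (\<epsilon> * s) * cmod (f y)" for s y
      by (simp add: norm_mult)
    have h_int: "integrable (lborel \<Otimes>\<^sub>M lborel) (\<lambda>(s, y). ?h s y)"
    proof (rule lborel_pair.Fubini_integrable)
      show "integrable lborel (\<lambda>s. LINT y|lborel. norm (case (s, y) of (s, y) \<Rightarrow> ?h s y))"
        unfolding prod.case h_norm using g_int by simp
      show "AE s in lborel. integrable lborel (\<lambda>y. case (s, y) of (s, y) \<Rightarrow> ?h s y)"
      proof (rule AE_I2)
        fix s
        have "integrable lborel (\<lambda>y. ?g (\<epsilon> * s) * cmod (f y))" using f by simp
        then show "integrable lborel (\<lambda>y. case (s, y) of (s, y) \<Rightarrow> ?h s y)"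
          by (rule Bochner_Integration.integrable_bound) (auto simp: norm_mult)
      qed
    qed measurable
    have "L \<epsilon> = (LINT s|lborel. LINT y|lborel. ?h s y)"
      unfolding L_def
    proof (rule Bochner_Integration.integral_cong)
      fix s
      have "F s * exp (- \<i> * of_real (s * x)) * of_real (?g (\<epsilon> * s))
          = (LINT y|lborel. f y * exp (\<i> * of_real (s * y)) * (exp (- \<i> * of_real (s * x)) * of_real (?g (\<epsilon> * s))))"
        unfolding F_def by simp
      also have "\<dots> = (LINT y|lborel. ?h s y)"
        by (rule Bochner_Integration.integral_cong) (simp_all add: right_diff_distrib exp_diff exp_minus divide_inverse)
      finally show "F s * exp (- \<i> * of_real (s * x)) * of_real (?g (\<epsilon> * s)) = (LINT y|lborel. ?h s y)" .
    qed simp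
    also have "\<dots> = (LINT y|lborel. LINT s|lborel. ?h s y)"
      using lborel_pair.Fubini_integral[OF h_int] by simp
    also have "\<dots> = (LINT y|lborel. f y * of_real (sqrt (2 * pi) / \<epsilon> * ?g ((y - x) / \<epsilon>)))"
    proof (rule Bochner_Integration.integral_cong)
      fix y
      have "(LINT s|lborel. ?h s y) = (LINT s|lborel. f y * (of_real (?g (\<epsilon> * s)) * exp (\<i> * of_real (s * (y - x)))))"
        by (rule Bochner_Integration.integral_cong) (simp_all add: mult_ac)
      also have "\<dots> = f y * (LINT s|lborel. of_real (?g (\<epsilon> * s)) * exp (\<i> * of_real (s * (y - x))))"
        by simp
      also have "\<dots> = f y * of_real (sqrt (2 * pi) / \<epsilon> * ?g ((y - x) / \<epsilon>))"
        by (simp only: gaussian_fourier_integral[OF \<epsilon>])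
      finally show "(LINT s|lborel. ?h s y) = f y * of_real (sqrt (2 * pi) / \<epsilon> * ?g ((y - x) / \<epsilon>))" .
    qed simp
    also have "\<dots> = \<epsilon> *\<^sub>R (LINT v|lborel. f (x + \<epsilon> * v) * of_real (sqrt (2 * pi) / \<epsilon> * ?g v))"
      using \<epsilon> by (subst lborel_integral_real_affine[of \<epsilon> _ x]) auto
    also have "(LINT v|lborel. f (x + \<epsilon> * v) * of_real (sqrt (2 * pi) / \<epsilon> * ?g v))
        = (LINT v|lborel. of_real (sqrt (2 * pi) / \<epsilon>) * (f (x + \<epsilon> * v) * of_real (?g v)))"
      by (rule Bochner_Integration.integral_cong) (simp_all add: mult_ac)
    also have "\<dots> = of_real (sqrt (2 * pi) / \<epsilon>) * R \<epsilon>"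
      unfolding R_def by (rule integral_mult_right_zero)
    finally show ?thesis using \<epsilon> by (simp add: scaleR_conv_of_real)
  qed
  define e where "e = (\<lambda>k. 1 / real (Suc k))"
  have e0: "0 < e k" for k by (simp add: e_def)
  have e_lim: "e \<longlonglongrightarrow> 0" unfolding e_def by (rule lim_1_over_real_power[of 1, simplified] LIMSEQ_Suc lim_inverse_n')+
  have "(\<lambda>k. L (e k)) \<longlonglongrightarrow> (LINT s|lborel. F s * exp (- \<i> * of_real (s * x)) * of_real (?g 0))"
    unfolding L_def
  proof (rule integral_dominated_convergence)
    show "integrable lborel (\<lambda>s. cmod (F s) * ?g 0)" using F by simp
    show "AE s in lborel. (\<lambda>k. F s * exp (- \<i> * of_real (s * x)) * of_real (?g (e k * s)))
        \<longlonglongrightarrow> F s * exp (- \<i> * of_real (s * x)) * of_real (?g 0)"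
    proof (rule AE_I2)
      fix s
      have "(\<lambda>k. ?g (e k * s)) \<longlonglongrightarrow> 1 / sqrt (2 * pi) * exp (- (0 * s)\<^sup>2 / 2)"
        unfolding std_normal_density_def by (intro tendsto_intros e_lim) auto
      then show "(\<lambda>k. F s * exp (- \<i> * of_real (s * x)) * of_real (?g (e k * s)))
        \<longlonglongrightarrow> F s * exp (- \<i> * of_real (s * x)) * of_real (?g 0)"
        by (intro tendsto_intros) (simp add: std_normal_density_def)
    qed
    show "AE s in lborel. norm (F s * exp (- \<i> * of_real (s * x)) * of_real (?g (e k * s))) \<le> cmod (F s) * ?g 0" for k
      by (rule AE_I2) (simp add: norm_mult mult_left_mono g_le)
  qed simp_all
  moreover have "(\<lambda>k. L (e k)) \<longlonglongrightarrow> of_real (sqrt (2 * pi)) * f x"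
  proof -
    have "(\<lambda>k. R (e k)) \<longlonglongrightarrow> (LINT v|lborel. f x * of_real (?g v))"
      unfolding R_def
    proof (rule integral_dominated_convergence)
      show "integrable lborel (\<lambda>v. B * ?g v)"
        using integrable_std_normal_moment[of 0] by simp
      show "AE v in lborel. (\<lambda>k. f (x + e k * v) * of_real (?g v)) \<longlonglongrightarrow> f x * of_real (?g v)"
      proof (rule AE_I2)
        fix v
        have "(\<lambda>k. x + e k * v) \<longlonglongrightarrow> x + 0 * v" by (intro tendsto_intros e_lim)
        then have "(\<lambda>k. f (x + e k * v)) \<longlonglongrightarrow> f x"
          using isCont_tendsto_compose[OF cont] by simp
        then show "(\<lambda>k. f (x + e k * v) * of_real (?g v)) \<longlonglongrightarrow> f x * of_real (?g v)"
          by (intro tendsto_intros)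
      qed
      show "AE v in lborel. norm (f (x + e k * v) * of_real (?g v)) \<le> B * ?g v" for k
        by (rule AE_I2) (simp add: norm_mult mult_right_mono bound)
    qed simp_all
    also have "(LINT v|lborel. f x * of_real (?g v)) = f x"
      using integral_std_normal_moment_even[of 0] by simp
    finally show ?thesis unfolding LR[OF e0] by (intro tendsto_intros)
  qed
  ultimately have "(LINT s|lborel. F s * exp (- \<i> * of_real (s * x)) * of_real (?g 0)) = of_real (sqrt (2 * pi)) * f x"
    by (rule LIMSEQ_unique)
  then have "(LINT s|lborel. F s * exp (- \<i> * of_real (s * x))) * of_real (?g 0) = of_real (sqrt (2 * pi)) * f x"
    by simp
  moreover have "?g 0 = 1 / sqrt (2 * pi)" by (simp add: std_normal_density_def)
  moreover obtain r where r: "r = sqrt (2 * pi)" by blast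
  ultimately have "(LINT s|lborel. F s * exp (- \<i> * of_real (s * x))) * of_real (1 / r) = of_real r * f x"
    by (simp only:)
  moreover have "r * r = 2 * pi" "r \<noteq> 0" by (simp_all add: r)
  ultimately show ?thesis by (simp add: field_simps flip: of_real_mult)
qed

text \<open>By the Mellin integral, \<open>Gamma (t s) * z powr (- t s)\<close> is the Fourier
  transform of \<open>exp (c y) * exp (- z exp y)\<close>; inversion recovers this function, and the
  factor \<open>exp (c y)\<close> cancels against the real part of \<open>t\<close>. The constant is
  \<open>2 * pi\<close> without \<i> because the integration variable is the real
  \<open>s\<close>.\<close>

lemma mellin_barnes_exp:
  fixes c y :: real and z :: complex
  assumes c: "0 < c" and z: "0 < Re z"
  defines "t \<equiv> \<lambda>s. complex_of_real c + \<i> * of_real s"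
  shows "(LINT s|lborel. Gamma (t s) * z powr (- t s) * exp (- t s * of_real y)) = of_real (2 * pi) * exp (- z * of_real (exp y))"
proof -
  define f where "f = (\<lambda>y. exp (of_real c * of_real y) * exp (- z * complex_of_real (exp y)))"
  have "(LINT s|lborel. Gamma (t s) * z powr (- t s) * exp (- \<i> * of_real (s * y))) = of_real (2 * pi) * f y"
  proof (rule fourier_inversion)
    show "integrable lborel f"
      using exp_Gamma_integral[of "of_real c" z] c z by (simp add: has_bochner_integral_iff f_def)
    show "integrable lborel (\<lambda>s. Gamma (t s) * z powr (- t s))"
      unfolding t_def by (rule Gamma_powr_vertical_integrable[OF c z])
    show "isCont f y" unfolding f_def by (intro continuous_intros)
    show "Gamma (t s) * z powr (- t s) = (LINT y|lborel. f y * exp (\<i> * of_real (s * y)))" for s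
    proof -
      have "Gamma (t s) * z powr (- t s) = (LINT y|lborel. exp (t s * of_real y) * exp (- z * of_real (exp y)))"
        using exp_Gamma_integral[of "t s" z] c z by (simp add: has_bochner_integral_iff t_def)
      also have "\<dots> = (LINT y|lborel. f y * exp (\<i> * of_real (s * y)))"
        by (rule Bochner_Integration.integral_cong) (simp_all add: f_def t_def ring_distribs exp_add mult_ac)
      finally show ?thesis .
    qed
    \<comment> \<open>The exponent \<open>c * y - Re z * exp y\<close> is concave with its maximum
      at \<open>y = ln (c / Re z)\<close>; the tangent bound \<open>1 + x \<le> exp x\<close> at
      that point gives the constant.\<close>
    show "cmod (f y) \<le> exp (c * (ln (c / Re z) - 1))" for y
    proof -
      let ?a = "ln (c / Re z)"
      have "Re z * exp y = c * exp (y - ?a)" using c z by (simp add: exp_diff)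
      moreover have "c * exp (y - ?a) \<ge> c * (1 + (y - ?a))"
        using c exp_ge_add_one_self[of "y - ?a"] by (intro mult_left_mono) auto
      ultimately have "c * y - Re z * exp y \<le> c * (?a - 1)"
        by (simp add: algebra_simps)
      then show ?thesis by (simp add: f_def norm_mult flip: exp_add)
    qed
  qed
  moreover have "(LINT s|lborel. Gamma (t s) * z powr (- t s) * exp (- t s * of_real y))
     = (LINT s|lborel. exp (- of_real c * of_real y) * (Gamma (t s) * z powr (- t s) * exp (- \<i> * of_real (s * y))))"
  proof (rule Bochner_Integration.integral_cong)
    fix s
    have "exp (- t s * of_real y) = exp (- of_real c * of_real y) * exp (- \<i> * of_real (s * y))"
      by (simp add: t_def algebra_simps flip: exp_add)
    then show "Gamma (t s) * z powr (- t s) * exp (- t s * of_real y)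
        = exp (- of_real c * of_real y) * (Gamma (t s) * z powr (- t s) * exp (- \<i> * of_real (s * y)))"
      by (simp only: mult_ac)
  qed simp
  ultimately show ?thesis by (simp add: f_def exp_minus)
qed

section \<open>Affine change of variables in finite products of Lebesgue measure\<close>

text \<open>Restriction to the index set keeps the values among the extensional functions that form
  the space of \<open>PiM\<close>. The translation \<open>v\<close> is there for the induction on
  the dimension: fixing one coordinate of a linear map leaves an inhomogeneous one.\<close>

definition affine_map :: "nat \<Rightarrow> real mat \<Rightarrow> (nat \<Rightarrow> real) \<Rightarrow> (nat \<Rightarrow> real) \<Rightarrow> nat \<Rightarrow> real" where
  "affine_map k A v x = (\<lambda>i\<in>{..<k}. v i + (\<Sum>j<k. A $$ (i, j) * x j))"

lemma measurable_affine_map [measurable]: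
  "affine_map k A v \<in> PiM {..<k} (\<lambda>_. lborel) \<rightarrow>\<^sub>M PiM {..<k} (\<lambda>_. lborel)"
  unfolding affine_map_def
  by (intro measurable_restrict) (auto intro!: borel_measurable_add borel_measurable_sum borel_measurable_times)

text \<open>Block elimination: \<open>A\<close> factors into an upper block triangular matrix with
  diagonal blocks \<open>?S\<close> and the corner entry, and a unit lower block triangular matrix
  that carries the last row divided by the corner.\<close>

lemma det_schur_complement_corner:
  fixes A :: "'a :: field mat"
  assumes A: "A \<in> carrier_mat (Suc k) (Suc k)" and d: "A $$ (k, k) \<noteq> 0"
  shows "Determinant.det A = A $$ (k, k) *
    Determinant.det (Matrix.mat k k (\<lambda>(i, j). A $$ (i, j) - A $$ (i, k) * A $$ (k, j) / A $$ (k, k)))"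
proof -
  let ?S = "Matrix.mat k k (\<lambda>(i, j). A $$ (i, j) - A $$ (i, k) * A $$ (k, j) / A $$ (k, k))"
  let ?b = "Matrix.mat k 1 (\<lambda>(i, j). A $$ (i, k))"
  let ?d = "Matrix.mat 1 1 (\<lambda>(i, j). A $$ (k, k))"
  let ?l = "Matrix.mat 1 k (\<lambda>(i, j). A $$ (k, j) / A $$ (k, k))"
  let ?U = "four_block_mat ?S ?b (0\<^sub>m 1 k) ?d"
  let ?L = "four_block_mat (1\<^sub>m k) (0\<^sub>m k 1) ?l (1\<^sub>m 1)"
  have dU: "Determinant.det ?U = Determinant.det ?S * A $$ (k, k)"
    by (subst det_four_block_mat_lower_left_zero) (auto simp: det_single)
  have dL: "Determinant.det ?L = 1"
    by (subst det_four_block_mat_upper_right_zero_col) auto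
  have eq: "A = ?U * ?L"
    by (subst mult_four_block_mat, rule carrier_matI, auto intro!: eq_matI
       simp: scalar_prod_def d less_Suc_eq)
    (use A d in \<open>auto simp: less_Suc_eq\<close>)
  have "Determinant.det (?U * ?L) = Determinant.det ?U * Determinant.det ?L"
    by (rule det_mult[of _ "k + 1"]) auto
  then have "Determinant.det A = Determinant.det ?S * A $$ (k, k)"
    using arg_cong[OF eq, of Determinant.det] by (simp only: dU dL mult_1_right)
  then show ?thesis by (simp only: mult.commute)
qed

text \<open>
  Substituting the last output coordinate for the last input coordinate leaves an affine map in the
  remaining coordinates whose matrix is the Schur complement of the corner entry.
\<close>

lemma nn_integral_PiM_affine_corner:
  fixes A :: "real mat"
  assumes IH: "\<And>S v f. S \<in> carrier_mat k k \<Longrightarrow> Determinant.det S \<noteq> 0 \<Longrightarrow> f \<in> borel_measurable (PiM {..<k} (\<lambda>_. lborel)) \<Longrightarrow>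
      integral\<^sup>N (PiM {..<k} (\<lambda>_. lborel)) f
      = ennreal \<bar>Determinant.det S\<bar> * (\<integral>\<^sup>+x. f (affine_map k S v x) \<partial>PiM {..<k} (\<lambda>_. lborel))"
    and A: "A \<in> carrier_mat (Suc k) (Suc k)" and det: "Determinant.det A \<noteq> 0" and d: "A $$ (k, k) \<noteq> 0"
    and f [measurable]: "f \<in> borel_measurable (PiM {..<Suc k} (\<lambda>_. lborel))"
  shows "integral\<^sup>N (PiM {..<Suc k} (\<lambda>_. lborel)) f
      = ennreal \<bar>Determinant.det A\<bar> * (\<integral>\<^sup>+x. f (affine_map (Suc k) A v x) \<partial>PiM {..<Suc k} (\<lambda>_. lborel))"
proof -
  interpret P: product_sigma_finite "\<lambda>_::nat. lborel :: real measure" by standard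
  define S where "S = Matrix.mat k k (\<lambda>(i, j). A $$ (i, j) - A $$ (i, k) * A $$ (k, j) / A $$ (k, k))"
  define d where "d = A $$ (k, k)"
  have d0: "d \<noteq> 0" using d by (simp add: d_def)
  have det_A: "Determinant.det A = d * Determinant.det S"
    unfolding S_def d_def by (rule det_schur_complement_corner[OF A d])
  have S: "S \<in> carrier_mat k k" "Determinant.det S \<noteq> 0"
    using det det_A by (auto simp: S_def)
  have ins: "{..<Suc k} = insert k {..<k}" by auto
  \<comment> \<open>Solving "output \<open>k\<close> equals \<open>s\<close>" for the input
    \<open>x k\<close> and inserting the result leaves the Schur complement as linear part and
    \<open>w s\<close> as translation. After Tonelli puts the \<open>s\<close>-integral outside, the
    induction hypothesis applies for each fixed \<open>s\<close> with this translation.\<close>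
  define w where "w = (\<lambda>s i. v i + A $$ (i, k) * (s - v k) / d)"
  define F where "F = (\<lambda>x. f ((affine_map k S (w (x k)) x)(k := x k)))"
  have "(\<lambda>x. (affine_map k S (w (x k)) x)(k := x k)) = (\<lambda>x. \<lambda>i\<in>{..<Suc k}. if i = k then x k else w (x k) i + (\<Sum>j<k. S $$ (i, j) * x j))"
    by (auto simp: affine_map_def fun_eq_iff)
  moreover have "\<dots> \<in> PiM {..<Suc k} (\<lambda>_. lborel) \<rightarrow>\<^sub>M PiM {..<Suc k} (\<lambda>_. lborel)"
    unfolding w_def
    by (intro measurable_restrict) (auto intro!: borel_measurable_add borel_measurable_sum borel_measurable_times
      borel_measurable_diff borel_measurable_divide measurable_If)
  ultimately have "(\<lambda>x. (affine_map k S (w (x k)) x)(k := x k)) \<in> PiM {..<Suc k} (\<lambda>_. lborel) \<rightarrow>\<^sub>M PiM {..<Suc k} (\<lambda>_. lborel)"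
    by simp
  then have F [measurable]: "F \<in> borel_measurable (PiM {..<Suc k} (\<lambda>_. lborel))"
    unfolding F_def by (rule measurable_compose) (rule f)
  have "affine_map k S v (x(k := s)) = affine_map k S v x" for v x s
    unfolding affine_map_def by (auto intro!: restrict_ext sum.cong)
  then have F_upd: "F (x(k := s)) = f ((affine_map k S (w s) x)(k := s))" for x s
    by (simp add: F_def)
  have "(\<lambda>x. x(k := s)) \<in> PiM {..<k} (\<lambda>_. lborel) \<rightarrow>\<^sub>M PiM {..<Suc k} (\<lambda>_. lborel)" for s :: real
    by (rule measurable_fun_upd[where J = "{..<k}"]) (auto simp: ins)
  then have f_upd: "(\<lambda>x. f (x(k := s))) \<in> borel_measurable (PiM {..<k} (\<lambda>_. lborel))" for s
    by (rule measurable_compose) (rule f)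
  have "(\<integral>\<^sup>+x. f (affine_map (Suc k) A v x) \<partial>PiM {..<Suc k} (\<lambda>_. lborel))
     = (\<integral>\<^sup>+x. (\<integral>\<^sup>+s. f (affine_map (Suc k) A v (x(k := s))) \<partial>lborel) \<partial>PiM {..<k} (\<lambda>_. lborel))"
    unfolding ins by (subst P.product_nn_integral_insert) (auto simp flip: ins)
  also have "\<dots> = (\<integral>\<^sup>+x. ennreal \<bar>1 / d\<bar> * (\<integral>\<^sup>+s. F (x(k := s)) \<partial>lborel) \<partial>PiM {..<k} (\<lambda>_. lborel))"
  proof (rule nn_integral_cong)
    fix x :: "nat \<Rightarrow> real" assume x: "x \<in> space (PiM {..<k} (\<lambda>_. lborel))"
    \<comment> \<open>For \<open>x k = t\<close> the output \<open>k\<close> vanishes, so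
      \<open>x k = t + s / d\<close> has output \<open>s\<close>.\<close>
    define t where "t = - (v k + (\<Sum>j<k. A $$ (k, j) * x j)) / d"
    have shift: "affine_map (Suc k) A v (x(k := t + 1 / d * s)) = (affine_map k S (w s) x)(k := s)" for s
    proof
      fix i
      have *: "(\<Sum>j<k. A $$ (i, j) * (if j = k then t + s / d else x j)) = (\<Sum>j<k. A $$ (i, j) * x j)"
        by (rule sum.cong) auto
      have "(\<Sum>j<k. S $$ (i, j) * x j) = (\<Sum>j<k. A $$ (i, j) * x j) - A $$ (i, k) / d * (\<Sum>j<k. A $$ (k, j) * x j)" if "i < k"
        using that by (simp add: S_def d_def sum_distrib_left left_diff_distrib mult.assoc flip: sum_subtractf)
      then show "affine_map (Suc k) A v (x(k := t + 1 / d * s)) i = ((affine_map k S (w s) x)(k := s)) i"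
        using d0 * by (cases "i = k"; cases "i < k") (auto simp: affine_map_def w_def t_def d_def[symmetric] field_simps)
    qed
    have "(\<lambda>s. x(k := s)) \<in> lborel \<rightarrow>\<^sub>M PiM {..<Suc k} (\<lambda>_. lborel)"
      using x unfolding ins by measurable
    then have m: "(\<lambda>s. f (affine_map (Suc k) A v (x(k := s)))) \<in> borel_measurable borel" by simp
    have "(\<integral>\<^sup>+s. f (affine_map (Suc k) A v (x(k := s))) \<partial>lborel)
       = ennreal \<bar>1 / d\<bar> * (\<integral>\<^sup>+s. f (affine_map (Suc k) A v (x(k := t + 1 / d * s))) \<partial>lborel)"
      using d0 m by (intro nn_integral_real_affine) auto
    then show "(\<integral>\<^sup>+s. f (affine_map (Suc k) A v (x(k := s))) \<partial>lborel) = ennreal \<bar>1 / d\<bar> * (\<integral>\<^sup>+s. F (x(k := s)) \<partial>lborel)"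
      by (simp only: shift F_upd)
  qed
  also have "\<dots> = ennreal \<bar>1 / d\<bar> * (\<integral>\<^sup>+x. (\<integral>\<^sup>+s. F (x(k := s)) \<partial>lborel) \<partial>PiM {..<k} (\<lambda>_. lborel))"
    by (rule nn_integral_cmult) (use F in \<open>simp add: ins, measurable\<close>)
  also have "(\<integral>\<^sup>+x. (\<integral>\<^sup>+s. F (x(k := s)) \<partial>lborel) \<partial>PiM {..<k} (\<lambda>_. lborel)) = integral\<^sup>N (PiM (insert k {..<k}) (\<lambda>_. lborel)) F"
    by (subst P.product_nn_integral_insert) (auto simp flip: ins)
  also have "\<dots> = (\<integral>\<^sup>+s. (\<integral>\<^sup>+x. F (x(k := s)) \<partial>PiM {..<k} (\<lambda>_. lborel)) \<partial>lborel)"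
    by (subst P.product_nn_integral_insert_rev) (auto simp flip: ins)
  finally have "ennreal \<bar>Determinant.det A\<bar> * (\<integral>\<^sup>+x. f (affine_map (Suc k) A v x) \<partial>PiM {..<Suc k} (\<lambda>_. lborel))
     = ennreal \<bar>Determinant.det S\<bar> * (\<integral>\<^sup>+s. (\<integral>\<^sup>+x. F (x(k := s)) \<partial>PiM {..<k} (\<lambda>_. lborel)) \<partial>lborel)"
    using d0 by (simp add: det_A abs_mult ennreal_mult mult.assoc[symmetric] flip: ennreal_mult)
  also have "\<dots> = (\<integral>\<^sup>+s. ennreal \<bar>Determinant.det S\<bar> * (\<integral>\<^sup>+x. F (x(k := s)) \<partial>PiM {..<k} (\<lambda>_. lborel)) \<partial>lborel)"
  proof (rule nn_integral_cmult[symmetric])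
    interpret Q: sigma_finite_measure "PiM {..<k} (\<lambda>_. lborel :: real measure)"
      by (rule P.sigma_finite) simp
    have "(\<lambda>p. (snd p)(k := fst p)) \<in> lborel \<Otimes>\<^sub>M PiM {..<k} (\<lambda>_. lborel) \<rightarrow>\<^sub>M PiM {..<Suc k} (\<lambda>_. lborel)"
      by (rule measurable_fun_upd[where J = "{..<k}"]) (auto simp: ins)
    from measurable_compose[OF this F]
    show "(\<lambda>s. \<integral>\<^sup>+x. F (x(k := s)) \<partial>PiM {..<k} (\<lambda>_. lborel)) \<in> borel_measurable lborel"
      by (intro Q.borel_measurable_nn_integral) (simp add: split_beta)
  qed
  also have "\<dots> = (\<integral>\<^sup>+s. (\<integral>\<^sup>+x. f (x(k := s)) \<partial>PiM {..<k} (\<lambda>_. lborel)) \<partial>lborel)"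
  proof (rule nn_integral_cong)
    fix s
    show "ennreal \<bar>Determinant.det S\<bar> * (\<integral>\<^sup>+x. F (x(k := s)) \<partial>PiM {..<k} (\<lambda>_. lborel)) = (\<integral>\<^sup>+x. f (x(k := s)) \<partial>PiM {..<k} (\<lambda>_. lborel))"
      using IH[OF S f_upd[of s], of "w s"] by (simp only: F_upd)
  qed
  also have "\<dots> = integral\<^sup>N (PiM (insert k {..<k}) (\<lambda>_. lborel)) f"
    by (subst P.product_nn_integral_insert_rev) (auto simp flip: ins)
  finally show ?thesis by (simp add: ins)
qed

text \<open>Nonnegative integrands allow every exchange of integrals by Tonelli. The induction
  generalises over the translation, which changes with the eliminated coordinate.\<close>

lemma nn_integral_PiM_affine:
  fixes A :: "real mat"
  assumes "A \<in> carrier_mat k k" and "Determinant.det A \<noteq> 0"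
    and "f \<in> borel_measurable (PiM {..<k} (\<lambda>_. lborel))"
  shows "integral\<^sup>N (PiM {..<k} (\<lambda>_. lborel)) f
      = ennreal \<bar>Determinant.det A\<bar> * (\<integral>\<^sup>+x. f (affine_map k A v x) \<partial>PiM {..<k} (\<lambda>_. lborel))"
  using assms
proof (induction k arbitrary: A v f)
  case 0
  have "Determinant.det A = 1" using 0 by (simp add: det_dim_zero)
  then show ?case by (simp add: PiM_empty nn_integral_count_space_finite affine_map_def restrict_def)
next
  case (Suc k)
  interpret P: product_sigma_finite "\<lambda>_::nat. lborel :: real measure" by standard
  have corner: "integral\<^sup>N (PiM {..<Suc k} (\<lambda>_. lborel)) f
      = ennreal \<bar>Determinant.det A\<bar> * (\<integral>\<^sup>+x. f (affine_map (Suc k) A v x) \<partial>PiM {..<Suc k} (\<lambda>_. lborel))"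
    if "A \<in> carrier_mat (Suc k) (Suc k)" "Determinant.det A \<noteq> 0" "A $$ (k, k) \<noteq> 0"
      "f \<in> borel_measurable (PiM {..<Suc k} (\<lambda>_. lborel))" for A :: "real mat" and v f
    by (rule nn_integral_PiM_affine_corner[OF _ that]) (rule Suc.IH)
  note f [measurable] = Suc.prems(3)
  show ?case
  proof (cases "A $$ (k, k) = 0")
    case False
    with Suc.prems show ?thesis by (intro corner) auto
  next
    case True
    have ins: "{..<Suc k} = insert k {..<k}" by auto
    obtain i where i: "i < k" "A $$ (i, k) \<noteq> 0"
    proof (rule ccontr)
      assume "\<not> thesis"
      with that have "\<And>i. i < k \<Longrightarrow> A $$ (i, k) = 0" by blast
      with True have "Determinant.det A = 0"
        using Suc.prems(1) by (subst laplace_expansion_column[of A "Suc k" k]) (auto simp: less_Suc_eq)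
      with Suc.prems(2) show False by simp
    qed
    \<comment> \<open>Adding row \<open>i\<close> to row \<open>k\<close> makes the corner nonzero; the shear undoing it preserves the measure.\<close>
    define A' where "A' = addrow 1 k i A"
    have A': "A' \<in> carrier_mat (Suc k) (Suc k)" "Determinant.det A' = Determinant.det A" "A' $$ (k, k) \<noteq> 0"
      using i True Suc.prems(1) by (auto simp: A'_def det_addrow[of i "Suc k"])
    \<comment> \<open>The translation undergoes the same row operation as the matrix, so that
      \<open>E\<close> undoes both at once.\<close>
    define v' where "v' = v(k := v k + v i)"
    define E where "E = (\<lambda>x :: nat \<Rightarrow> real. x(k := x k - x i))"
    have E: "E \<in> PiM {..<Suc k} (\<lambda>_. lborel) \<rightarrow>\<^sub>M PiM {..<Suc k} (\<lambda>_. lborel)"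
      unfolding E_def using i
      by (intro measurable_fun_upd[where J = "{..<Suc k}"]) auto
    have fE [measurable]: "(\<lambda>x. f (E x)) \<in> borel_measurable (PiM {..<Suc k} (\<lambda>_. lborel))"
      by (rule measurable_compose[OF E f])
    have "E (affine_map (Suc k) A' v' x) = affine_map (Suc k) A v x" for x
    proof
      fix j
      have "(\<Sum>j<Suc k. (A $$ (i, j) + A $$ (k, j)) * x j) = (\<Sum>j<Suc k. A $$ (i, j) * x j) + (\<Sum>j<Suc k. A $$ (k, j) * x j)"
        by (simp only: distrib_right sum.distrib)
      then show "E (affine_map (Suc k) A' v' x) j = affine_map (Suc k) A v x j"
        using i Suc.prems(1) by (auto simp: E_def affine_map_def A'_def v'_def)
    qed
    then have "(\<integral>\<^sup>+x. f (E x) \<partial>PiM {..<Suc k} (\<lambda>_. lborel))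
        = ennreal \<bar>Determinant.det A\<bar> * (\<integral>\<^sup>+x. f (affine_map (Suc k) A v x) \<partial>PiM {..<Suc k} (\<lambda>_. lborel))"
      using corner[OF A'(1) _ A'(3) fE, where v = v'] Suc.prems(2) by (simp add: A'(2))
    moreover have "(\<integral>\<^sup>+x. f (E x) \<partial>PiM {..<Suc k} (\<lambda>_. lborel)) = integral\<^sup>N (PiM {..<Suc k} (\<lambda>_. lborel)) f"
    proof -
      have "(\<integral>\<^sup>+x. f (E x) \<partial>PiM {..<Suc k} (\<lambda>_. lborel))
         = (\<integral>\<^sup>+x. (\<integral>\<^sup>+s. f (E (x(k := s))) \<partial>lborel) \<partial>PiM {..<k} (\<lambda>_. lborel))"
        unfolding ins by (subst P.product_nn_integral_insert) (auto simp flip: ins)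
      also have "\<dots> = (\<integral>\<^sup>+x. (\<integral>\<^sup>+s. f (x(k := s)) \<partial>lborel) \<partial>PiM {..<k} (\<lambda>_. lborel))"
      proof (rule nn_integral_cong)
        fix x :: "nat \<Rightarrow> real" assume x: "x \<in> space (PiM {..<k} (\<lambda>_. lborel))"
        have "(\<lambda>s. x(k := s)) \<in> lborel \<rightarrow>\<^sub>M PiM {..<Suc k} (\<lambda>_. lborel)"
          using x unfolding ins by measurable
        then have "(\<lambda>s. f (x(k := s))) \<in> borel_measurable borel" by simp
        from nn_integral_real_affine[OF this, of 1 "- x i"] i
        show "(\<integral>\<^sup>+s. f (E (x(k := s))) \<partial>lborel) = (\<integral>\<^sup>+s. f (x(k := s)) \<partial>lborel)"
          by (simp add: E_def)
      qed
      also have "\<dots> = integral\<^sup>N (PiM {..<Suc k} (\<lambda>_. lborel)) f"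
        unfolding ins by (subst P.product_nn_integral_insert) (auto simp flip: ins)
      finally show ?thesis .
    qed
    ultimately show ?thesis by simp
  qed
qed

text \<open>As an identity of measures the rule passes to integrability and to Bochner integrals
  alike. The determinant stands on the image side, which avoids a division in
  \<open>ennreal\<close>.\<close>

lemma PiM_lborel_affine:
  fixes A :: "real mat"
  assumes A: "A \<in> carrier_mat k k" and det: "Determinant.det A \<noteq> 0"
  shows "PiM {..<k} (\<lambda>_. lborel) = density (distr (PiM {..<k} (\<lambda>_. lborel)) (PiM {..<k} (\<lambda>_. lborel)) (affine_map k A v)) (\<lambda>_. ennreal \<bar>Determinant.det A\<bar>)"
proof (rule measure_eqI)
  fix X assume X: "X \<in> sets (PiM {..<k} (\<lambda>_. lborel :: real measure))"
  have "emeasure (distr (PiM {..<k} (\<lambda>_. lborel)) (PiM {..<k} (\<lambda>_. lborel)) (affine_map k A v)) X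
      = (\<integral>\<^sup>+x. indicator X (affine_map k A v x) \<partial>PiM {..<k} (\<lambda>_. lborel))"
    using X by (subst nn_integral_indicator[symmetric], simp, subst nn_integral_distr) auto
  with X show "emeasure (PiM {..<k} (\<lambda>_. lborel)) X
     = emeasure (density (distr (PiM {..<k} (\<lambda>_. lborel)) (PiM {..<k} (\<lambda>_. lborel)) (affine_map k A v)) (\<lambda>_. ennreal \<bar>Determinant.det A\<bar>)) X"
    using nn_integral_PiM_affine[OF A det, of "indicator X" v]
    by (simp add: emeasure_density nn_integral_cmult)
qed simp

lemma
  fixes A :: "real mat" and f :: "(nat \<Rightarrow> real) \<Rightarrow> 'b :: {banach, second_countable_topology}"
  assumes A: "A \<in> carrier_mat k k" and det: "Determinant.det A \<noteq> 0"
    and f: "f \<in> borel_measurable (PiM {..<k} (\<lambda>_. lborel))"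
  shows integrable_PiM_affine_iff: "integrable (PiM {..<k} (\<lambda>_. lborel)) (\<lambda>x. f (affine_map k A v x)) \<longleftrightarrow> integrable (PiM {..<k} (\<lambda>_. lborel)) f" (is ?A)
    and integral_PiM_affine: "(LINT x|PiM {..<k} (\<lambda>_. lborel). f (affine_map k A v x)) = (LINT x|PiM {..<k} (\<lambda>_. lborel). f x) /\<^sub>R \<bar>Determinant.det A\<bar>" (is ?B)
proof -
  let ?M = "PiM {..<k} (\<lambda>_. lborel :: real measure)"
  note eq = PiM_lborel_affine[OF A det, of v]
  let ?D = "distr ?M ?M (affine_map k A v)" and ?c = "\<bar>Determinant.det A\<bar>"
  have "integrable ?M f \<longleftrightarrow> integrable (density ?D (\<lambda>_. ennreal ?c)) f"
    by (subst eq) (rule refl)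
  also have "\<dots> \<longleftrightarrow> integrable ?D (\<lambda>x. ?c *\<^sub>R f x)"
    by (rule integrable_density) (use f in simp_all)
  also have "\<dots> \<longleftrightarrow> integrable ?D f"
  proof
    assume "integrable ?D (\<lambda>x. ?c *\<^sub>R f x)"
    then have "integrable ?D (\<lambda>x. inverse ?c *\<^sub>R (?c *\<^sub>R f x))" by (rule integrable_scaleR_right)
    then show "integrable ?D f" using det by (simp add: divide_inverse[symmetric])
  qed (rule integrable_scaleR_right)
  also have "\<dots> \<longleftrightarrow> integrable ?M (\<lambda>x. f (affine_map k A v x))"
    using f by (subst integrable_distr_eq) auto
  finally show ?A by simp
  have "(LINT x|?M. f x) = (LINT x|density ?D (\<lambda>_. ennreal ?c). f x)"
    by (subst eq) (rule refl)
  also have "\<dots> = (LINT x|?D. ?c *\<^sub>R f x)"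
    by (rule integral_density) (use f in simp_all)
  also have "\<dots> = ?c *\<^sub>R (LINT x|?D. f x)"
    by (rule integral_scaleR_right)
  also have "(LINT x|distr ?M ?M (affine_map k A v). f x) = (LINT x|?M. f (affine_map k A v x))"
    using f by (subst integral_distr) auto
  finally show ?B using det by simp
qed

section \<open>Exponential substitution in finite products\<close>

lemma density_PiM:
  assumes I: "finite I" and M: "product_sigma_finite M" and D: "product_sigma_finite (\<lambda>i. density (M i) (h i))"
    and h: "\<And>i. i \<in> I \<Longrightarrow> h i \<in> borel_measurable (M i)"
  shows "density (PiM I M) (\<lambda>x. \<Prod>i\<in>I. h i (x i)) = PiM I (\<lambda>i. density (M i) (h i))"
proof -
  interpret M: product_sigma_finite M by (rule M)
  interpret D: product_sigma_finite "\<lambda>i. density (M i) (h i)" by (rule D)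
  note h [measurable]
  show ?thesis
  proof (rule D.PiM_eqI[OF I])
    show "sets (density (PiM I M) (\<lambda>x. \<Prod>i\<in>I. h i (x i))) = sets (PiM I (\<lambda>i. density (M i) (h i)))"
      by (simp, rule sets_PiM_cong) auto
    fix A assume "\<And>i. i \<in> I \<Longrightarrow> A i \<in> sets (density (M i) (h i))"
    then have A [measurable]: "i \<in> I \<Longrightarrow> A i \<in> sets (M i)" for i by simp
    have "emeasure (density (PiM I M) (\<lambda>x. \<Prod>i\<in>I. h i (x i))) (Pi\<^sub>E I A)
        = (\<integral>\<^sup>+x. (\<Prod>i\<in>I. h i (x i)) * indicator (Pi\<^sub>E I A) x \<partial>PiM I M)"
      using I by (intro emeasure_density) (auto intro!: sets_PiM_I_finite A)
    also have "\<dots> = (\<integral>\<^sup>+x. (\<Prod>i\<in>I. h i (x i) * indicator (A i) (x i)) \<partial>PiM I M)"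
    proof (rule nn_integral_cong)
      fix x assume "x \<in> space (PiM I M)"
      then have "indicator (Pi\<^sub>E I A) x = (\<Prod>i\<in>I. indicator (A i) (x i) :: ennreal)"
        using I by (auto simp: indicator_def space_PiM PiE_iff prod.If_cases split: if_splits)
      then show "(\<Prod>i\<in>I. h i (x i)) * indicator (Pi\<^sub>E I A) x = (\<Prod>i\<in>I. h i (x i) * indicator (A i) (x i))"
        by (simp add: prod.distrib)
    qed
    also have "\<dots> = (\<Prod>i\<in>I. \<integral>\<^sup>+y. h i y * indicator (A i) y \<partial>M i)"
      using I by (intro M.product_nn_integral_prod) auto
    also have "\<dots> = (\<Prod>i\<in>I. emeasure (density (M i) (h i)) (A i))"
      by (intro prod.cong emeasure_density[symmetric]) auto
    finally show "emeasure (density (PiM I M) (\<lambda>x. \<Prod>i\<in>I. h i (x i))) (Pi\<^sub>E I A) = (\<Prod>i\<in>I. emeasure (density (M i) (h i)) (A i))" .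
  qed
qed

lemma distr_PiM_componentwise:
  assumes I: "finite I" and M: "product_sigma_finite M" and D: "product_sigma_finite (\<lambda>i. distr (M i) (N i) (g i))"
    and g: "\<And>i. i \<in> I \<Longrightarrow> g i \<in> M i \<rightarrow>\<^sub>M N i"
  shows "distr (PiM I M) (PiM I N) (\<lambda>x. \<lambda>i\<in>I. g i (x i)) = PiM I (\<lambda>i. distr (M i) (N i) (g i))"
proof -
  interpret M: product_sigma_finite M by (rule M)
  interpret D: product_sigma_finite "\<lambda>i. distr (M i) (N i) (g i)" by (rule D)
  note g [measurable]
  show ?thesis
  proof (rule D.PiM_eqI[OF I])
    show "sets (distr (PiM I M) (PiM I N) (\<lambda>x. \<lambda>i\<in>I. g i (x i))) = sets (PiM I (\<lambda>i. distr (M i) (N i) (g i)))"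
      by (simp, rule sets_PiM_cong) auto
    fix A assume "\<And>i. i \<in> I \<Longrightarrow> A i \<in> sets (distr (M i) (N i) (g i))"
    then have A: "i \<in> I \<Longrightarrow> A i \<in> sets (N i)" for i by simp
    have "(\<lambda>x. \<lambda>i\<in>I. g i (x i)) -` Pi\<^sub>E I A \<inter> space (PiM I M) = (\<Pi>\<^sub>E i\<in>I. g i -` A i \<inter> space (M i))"
      by (auto simp: space_PiM PiE_iff)
    moreover have "i \<in> I \<Longrightarrow> g i -` A i \<inter> space (M i) \<in> sets (M i)" for i
      using A g by (blast intro: measurable_sets)
    ultimately have "emeasure (distr (PiM I M) (PiM I N) (\<lambda>x. \<lambda>i\<in>I. g i (x i))) (Pi\<^sub>E I A) = (\<Prod>i\<in>I. emeasure (M i) (g i -` A i \<inter> space (M i)))"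
      using I A by (subst emeasure_distr) (auto intro!: sets_PiM_I_finite measurable_restrict M.emeasure_PiM)
    also have "\<dots> = (\<Prod>i\<in>I. emeasure (distr (M i) (N i) (g i)) (A i))"
      using A by (intro prod.cong emeasure_distr[symmetric]) auto
    finally show "emeasure (distr (PiM I M) (PiM I N) (\<lambda>x. \<lambda>i\<in>I. g i (x i))) (Pi\<^sub>E I A) = (\<Prod>i\<in>I. emeasure (distr (M i) (N i) (g i)) (A i))" .
  qed
qed

text \<open>Lebesgue measure on the positive orthant is the image under the coordinatewise
  exponential of a product density, so the equation needs only measurability of \<open>f\<close>; if
  the integrals diverge, both sides are 0 by convention.\<close>

lemma integral_PiM_exp_substitution:
  fixes f :: "('i \<Rightarrow> real) \<Rightarrow> 'b :: {banach, second_countable_topology}"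
  assumes I: "finite I" and f [measurable]: "f \<in> borel_measurable (PiM I (\<lambda>_. lborel))"
  shows "(LINT x : {x. \<forall>i\<in>I. 0 < x i} | PiM I (\<lambda>_. lborel). f x)
    = (LINT x | PiM I (\<lambda>_. lborel). (\<Prod>i\<in>I. exp (x i)) *\<^sub>R f (\<lambda>i\<in>I. exp (x i)))"
proof -
  let ?M = "PiM I (\<lambda>_. lborel :: real measure)"
  let ?E = "density lborel (\<lambda>y. ennreal (exp y))"
  let ?D = "density lborel (indicator {0<..}) :: real measure"
  interpret M: product_sigma_finite "\<lambda>_::'i. lborel :: real measure" by standard
  have D: "product_sigma_finite (\<lambda>_::'i. ?D)" and E: "product_sigma_finite (\<lambda>_::'i. ?E)"
    unfolding product_sigma_finite_def
    by (auto simp: sigma_finite_measure.sigma_finite_iff_density_finite[OF sigma_finite_lborel] indicator_def)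
  have ind: "ennreal (indicator {x. \<forall>i\<in>I. 0 < x i} x) = (\<Prod>i\<in>I. indicator {0<..} (x i))" for x :: "'i \<Rightarrow> real"
    using I by (auto simp: indicator_def prod.If_cases split: if_splits)
  have "(\<lambda>x :: 'i \<Rightarrow> real. \<Prod>i\<in>I. indicator {0<..} (x i) :: real) \<in> borel_measurable ?M"
    by measurable
  moreover have "(\<Prod>i\<in>I. indicator {0<..} (x i) :: real) = indicator {x. \<forall>i\<in>I. 0 < x i} x" for x :: "'i \<Rightarrow> real"
    using I by (auto simp: indicator_def prod.If_cases split: if_splits)
  ultimately have ind_meas: "(\<lambda>x :: 'i \<Rightarrow> real. indicator {x. \<forall>i\<in>I. 0 < x i} x :: real) \<in> borel_measurable ?M"
    by simp
  have Ex: "(\<lambda>x. \<lambda>i\<in>I. exp (x i)) \<in> ?M \<rightarrow>\<^sub>M ?M"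
    by (intro measurable_restrict) auto
  have fEx [measurable]: "(\<lambda>x. f (\<lambda>i\<in>I. exp (x i))) \<in> borel_measurable ?M"
    by (rule measurable_compose[OF Ex f])
  have "density ?M (\<lambda>x. ennreal (indicator {x. \<forall>i\<in>I. 0 < x i} x)) = PiM I (\<lambda>_. ?D)"
    unfolding ind by (rule density_PiM[OF I M.product_sigma_finite_axioms D]) auto
  also have "\<dots> = PiM I (\<lambda>_. distr ?E lborel exp)"
    by (simp add: distr_exp_lborel cong: distr_cong)
  also have "\<dots> = distr (PiM I (\<lambda>_. ?E)) ?M (\<lambda>x. \<lambda>i\<in>I. exp (x i))"
    using D by (intro distr_PiM_componentwise[symmetric, OF I E]) (simp_all add: distr_exp_lborel cong: distr_cong)
  also have "PiM I (\<lambda>_. ?E) = density ?M (\<lambda>x. \<Prod>i\<in>I. ennreal (exp (x i)))"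
    by (rule density_PiM[OF I M.product_sigma_finite_axioms E, symmetric]) auto
  also have "\<dots> = density ?M (\<lambda>x. ennreal (\<Prod>i\<in>I. exp (x i)))"
    by (simp add: prod_ennreal)
  finally have eq: "density ?M (\<lambda>x. ennreal (indicator {x. \<forall>i\<in>I. 0 < x i} x))
     = distr (density ?M (\<lambda>x. ennreal (\<Prod>i\<in>I. exp (x i)))) ?M (\<lambda>x. \<lambda>i\<in>I. exp (x i))" .
  have "(LINT x : {x. \<forall>i\<in>I. 0 < x i} | ?M. f x) = (LINT x|density ?M (\<lambda>x. ennreal (indicator {x. \<forall>i\<in>I. 0 < x i} x)). f x)"
    unfolding set_lebesgue_integral_def by (rule integral_density[symmetric]) (use ind_meas in auto)
  also have "\<dots> = (LINT x|density ?M (\<lambda>x. ennreal (\<Prod>i\<in>I. exp (x i))). f (\<lambda>i\<in>I. exp (x i)))"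
    unfolding eq using Ex by (subst integral_distr) auto
  also have "\<dots> = (LINT x | ?M. (\<Prod>i\<in>I. exp (x i)) *\<^sub>R f (\<lambda>i\<in>I. exp (x i)))"
    by (rule integral_density) (auto intro!: prod_nonneg)
  finally show ?thesis .
qed

section \<open>Splitting off the Mellin coordinate\<close>

text \<open>The new coordinate goes to index 0, where the row of ones and \<open>nu0\<close> sit;
  the logarithms of the Feynman variables move up by one, as in \<open>colA\<close> and
  \<open>nuvec\<close>.\<close>

definition seq_cons :: "nat \<Rightarrow> (nat \<Rightarrow> real) \<Rightarrow> real \<Rightarrow> nat \<Rightarrow> real" where
  "seq_cons n x y = (\<lambda>i\<in>{..<Suc n}. case i of 0 \<Rightarrow> y | Suc j \<Rightarrow> x j)"

lemma distr_seq_cons: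
  "distr (PiM {..<n} (\<lambda>_. lborel) \<Otimes>\<^sub>M lborel) (PiM {..<Suc n} (\<lambda>_. lborel)) (\<lambda>(x, y). seq_cons n x y) = PiM {..<Suc n} (\<lambda>_. lborel)"
  and measurable_seq_cons: "(\<lambda>(x, y). seq_cons n x y) \<in> PiM {..<n} (\<lambda>_. lborel) \<Otimes>\<^sub>M lborel \<rightarrow>\<^sub>M PiM {..<Suc n} (\<lambda>_. lborel)"
proof -
  let ?M = "PiM {..<n} (\<lambda>_. lborel :: real measure)"
  interpret P: product_sigma_finite "\<lambda>_::nat. lborel :: real measure" by standard
  interpret Q: sigma_finite_measure ?M by (rule P.sigma_finite) simp
  have "(\<lambda>p. \<lambda>i\<in>{..<Suc n}. case i of 0 \<Rightarrow> snd p | Suc j \<Rightarrow> fst p j) \<in> ?M \<Otimes>\<^sub>M lborel \<rightarrow>\<^sub>M PiM {..<Suc n} (\<lambda>_. lborel)"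
  proof (rule measurable_restrict)
    fix i assume "i \<in> {..<Suc n}"
    then show "(\<lambda>p. case i of 0 \<Rightarrow> snd p | Suc j \<Rightarrow> fst p j) \<in> ?M \<Otimes>\<^sub>M lborel \<rightarrow>\<^sub>M (lborel :: real measure)"
      by (cases i) auto
  qed
  then show meas: "(\<lambda>(x, y). seq_cons n x y) \<in> ?M \<Otimes>\<^sub>M lborel \<rightarrow>\<^sub>M PiM {..<Suc n} (\<lambda>_. lborel)"
    by (simp add: seq_cons_def split_beta)
  show "distr (?M \<Otimes>\<^sub>M lborel) (PiM {..<Suc n} (\<lambda>_. lborel)) (\<lambda>(x, y). seq_cons n x y) = PiM {..<Suc n} (\<lambda>_. lborel)"
  proof (rule P.PiM_eqI)
    fix A :: "nat \<Rightarrow> real set" assume A: "\<And>i. i \<in> {..<Suc n} \<Longrightarrow> A i \<in> sets lborel"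
    have "seq_cons n x y \<in> Pi\<^sub>E {..<Suc n} A \<longleftrightarrow> (\<forall>i<Suc n. (case i of 0 \<Rightarrow> y | Suc j \<Rightarrow> x j) \<in> A i)" for x y
      by (simp add: seq_cons_def PiE_iff Ball_def)
    then have "seq_cons n x y \<in> Pi\<^sub>E {..<Suc n} A \<longleftrightarrow> y \<in> A 0 \<and> (\<forall>i<n. x i \<in> A (Suc i))" for x y
      by (simp only: All_less_Suc2 nat.case)
    then have "(\<lambda>(x, y). seq_cons n x y) -` Pi\<^sub>E {..<Suc n} A \<inter> space (?M \<Otimes>\<^sub>M lborel) = (\<Pi>\<^sub>E i\<in>{..<n}. A (Suc i)) \<times> A 0"
      by (simp add: set_eq_iff space_pair_measure space_PiM PiE_iff Ball_def) blast
    then have "emeasure (distr (?M \<Otimes>\<^sub>M lborel) (PiM {..<Suc n} (\<lambda>_. lborel)) (\<lambda>(x, y). seq_cons n x y)) (Pi\<^sub>E {..<Suc n} A)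
       = emeasure (?M \<Otimes>\<^sub>M lborel) ((\<Pi>\<^sub>E i\<in>{..<n}. A (Suc i)) \<times> A 0)"
      using A by (subst emeasure_distr[OF meas]) (auto intro!: sets_PiM_I_finite)
    also have "\<dots> = (\<Prod>i<n. emeasure lborel (A (Suc i))) * emeasure lborel (A 0)"
      using A P.emeasure_PiM[of "{..<n}" "\<lambda>i. A (Suc i)"]
      by (subst lborel.emeasure_pair_measure_Times) (auto intro!: sets_PiM_I_finite)
    finally show "emeasure (distr (?M \<Otimes>\<^sub>M lborel) (PiM {..<Suc n} (\<lambda>_. lborel)) (\<lambda>(x, y). seq_cons n x y)) (Pi\<^sub>E {..<Suc n} A)
        = (\<Prod>i<Suc n. emeasure lborel (A i))"
      by (simp add: prod.lessThan_Suc_shift mult.commute del: prod.lessThan_Suc)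
  qed auto
qed

lemma integral_seq_cons:
  fixes f :: "(nat \<Rightarrow> real) \<Rightarrow> 'b :: {banach, second_countable_topology}"
  assumes f: "integrable (PiM {..<Suc n} (\<lambda>_. lborel)) f"
  shows "(LINT x|PiM {..<Suc n} (\<lambda>_. lborel). f x) = (LINT x|PiM {..<n} (\<lambda>_. lborel). LINT y|lborel. f (seq_cons n x y))"
proof -
  let ?M = "PiM {..<n} (\<lambda>_. lborel :: real measure)"
  interpret P: product_sigma_finite "\<lambda>_::nat. lborel :: real measure" by standard
  interpret Q: sigma_finite_measure ?M by (rule P.sigma_finite) simp
  interpret PQ: pair_sigma_finite ?M lborel by standard
  have i: "integrable (?M \<Otimes>\<^sub>M lborel) (\<lambda>p. f (case p of (x, y) \<Rightarrow> seq_cons n x y))"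
    using f by (intro integrable_distr[OF measurable_seq_cons]) (simp add: distr_seq_cons)
  have "(LINT x|PiM {..<Suc n} (\<lambda>_. lborel). f x) = (LINT p|(?M \<Otimes>\<^sub>M lborel). f (case p of (x, y) \<Rightarrow> seq_cons n x y))"
    using f measurable_seq_cons by (subst distr_seq_cons[symmetric], subst integral_distr) auto
  also have "\<dots> = (LINT x|?M. LINT y|lborel. f (seq_cons n x y))"
    using PQ.integral_fst'[OF i] by simp
  finally show ?thesis .
qed

section \<open>The multidimensional Mellin-Barnes representation\<close>

text \<open>Here \<open>e\<close> enumerates \<sigma>, \<open>K\<close> is its complement, and the
  exponents \<open>p s\<close> enter only through the linear system that determines them. The
  hypothesis that \<open>Re (p s l)\<close> is a constant \<open>\<rho> l\<close> is what makes the
  joint modulus a product.\<close>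

lemma mellin_barnes_change_of_variables:
  fixes \<alpha> :: "nat \<Rightarrow> nat \<Rightarrow> real" and e :: "nat \<Rightarrow> nat" and K :: "nat set" and \<nu> z :: "nat \<Rightarrow> complex"
    and c \<rho> :: "nat \<Rightarrow> real" and p :: "(nat \<Rightarrow> real) \<Rightarrow> nat \<Rightarrow> complex" and k :: nat
  defines "L \<equiv> \<lambda>j x. \<Sum>i<k. \<alpha> j i * x i"
    and "t \<equiv> \<lambda>\<kappa> y. complex_of_real (c \<kappa>) + \<i> * of_real y"
    and "A \<equiv> Matrix.mat k k (\<lambda>(l, i). \<alpha> (e l) i)"
  defines "F \<equiv> \<lambda>x. exp (\<Sum>i<k. \<nu> i * of_real (x i)) * (\<Prod>l<k. exp (- z (e l) * of_real (exp (L (e l) x))))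
      * (\<Prod>\<kappa>\<in>K. exp (- z \<kappa> * of_real (exp (L \<kappa> x))))"
  assumes K: "finite K" and det: "Determinant.det A \<noteq> 0"
    and z: "\<And>l. l < k \<Longrightarrow> 0 < Re (z (e l))" and zK: "\<And>\<kappa>. \<kappa> \<in> K \<Longrightarrow> 0 < Re (z \<kappa>)"
    and c: "\<And>\<kappa>. \<kappa> \<in> K \<Longrightarrow> 0 < c \<kappa>"
    and p: "\<And>s i. i < k \<Longrightarrow> (\<Sum>l<k. p s l * \<alpha> (e l) i) + (\<Sum>\<kappa>\<in>K. t \<kappa> (s \<kappa>) * \<alpha> \<kappa> i) = \<nu> i"
    and \<rho>: "\<And>s l. l < k \<Longrightarrow> Re (p s l) = \<rho> l" "\<And>l. l < k \<Longrightarrow> 0 < \<rho> l"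
  shows "integrable (PiM {..<k} (\<lambda>_. lborel)) F" (is ?int)
    and "(LINT x|PiM {..<k} (\<lambda>_. lborel). F x) = (LINT s|PiM K (\<lambda>_. lborel).
          (\<Prod>\<kappa>\<in>K. Gamma (t \<kappa> (s \<kappa>)) * z \<kappa> powr (- t \<kappa> (s \<kappa>))) * (\<Prod>l<k. Gamma (p s l) * z (e l) powr (- p s l)))
          / (of_real (2 * pi) ^ card K * of_real \<bar>Determinant.det A\<bar>)" (is ?eq)
proof -
  let ?M = "PiM {..<k} (\<lambda>_. lborel :: real measure)" and ?N = "PiM K (\<lambda>_. lborel :: real measure)"
  interpret P: product_sigma_finite "\<lambda>_::nat. lborel :: real measure" by standard
  interpret M: sigma_finite_measure ?M by (rule P.sigma_finite) simp
  interpret N: sigma_finite_measure ?N by (rule P.sigma_finite) (rule K)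
  interpret MN: pair_sigma_finite ?M ?N by standard
  define g where "g = (\<lambda>\<kappa> y. Gamma (t \<kappa> y) * z \<kappa> powr (- t \<kappa> y))"
  have g_int: "integrable lborel (g \<kappa>)" if "\<kappa> \<in> K" for \<kappa>
    unfolding g_def t_def using c[OF that] zK[OF that] by (rule Gamma_powr_vertical_integrable)
  then have g_meas [measurable]: "g \<kappa> \<in> borel_measurable borel" if "\<kappa> \<in> K" for \<kappa>
    using that by auto
  define E where "E = (\<lambda>x. \<Prod>l<k. exp (- z (e l) * of_real (exp (L (e l) x))))"
  define Q where "Q = (\<lambda>s x. exp ((\<Sum>i<k. \<nu> i * of_real (x i)) - (\<Sum>\<kappa>\<in>K. t \<kappa> (s \<kappa>) * of_real (L \<kappa> x))) * E x)"
  define h where "h = (\<lambda>s l y. exp (p s l * of_real y) * exp (- z (e l) * of_real (exp y)))"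
  have aff: "affine_map k A (\<lambda>_. 0) x l = L (e l) x" if "l < k" for x l
    using that by (simp add: affine_map_def A_def L_def)
  have L_meas [measurable]: "L j \<in> borel_measurable ?M" for j
    unfolding L_def by measurable
  \<comment> \<open>The system for \<open>p\<close> says that the form with coefficients \<nu>,
    minus the contour part, equals the combination of the \<open>L (e l)\<close> with coefficients
    \<open>p s l\<close>; in these coordinates the variables separate.\<close>
  have Q_h: "Q s x = (\<Prod>l<k. h s l (affine_map k A (\<lambda>_. 0) x l))" for s x
  proof -
    have "(\<Sum>l<k. p s l * of_real (L (e l) x)) + (\<Sum>\<kappa>\<in>K. t \<kappa> (s \<kappa>) * of_real (L \<kappa> x))
        = (\<Sum>i<k. ((\<Sum>l<k. p s l * \<alpha> (e l) i) + (\<Sum>\<kappa>\<in>K. t \<kappa> (s \<kappa>) * \<alpha> \<kappa> i)) * of_real (x i))"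
    proof -
      have "(\<Sum>l<k. p s l * of_real (L (e l) x)) = (\<Sum>i<k. (\<Sum>l<k. p s l * \<alpha> (e l) i) * of_real (x i))"
        unfolding L_def by (simp add: sum_distrib_left sum_distrib_right mult.assoc, rule sum.swap)
      moreover have "(\<Sum>\<kappa>\<in>K. t \<kappa> (s \<kappa>) * of_real (L \<kappa> x)) = (\<Sum>i<k. (\<Sum>\<kappa>\<in>K. t \<kappa> (s \<kappa>) * \<alpha> \<kappa> i) * of_real (x i))"
        unfolding L_def by (simp add: sum_distrib_left sum_distrib_right mult.assoc, rule sum.swap)
      ultimately show ?thesis by (simp add: distrib_right sum.distrib)
    qed
    also have "\<dots> = (\<Sum>i<k. \<nu> i * of_real (x i))"
      by (rule sum.cong) (simp_all add: p)
    finally have "(\<Sum>i<k. \<nu> i * of_real (x i)) - (\<Sum>\<kappa>\<in>K. t \<kappa> (s \<kappa>) * of_real (L \<kappa> x)) = (\<Sum>l<k. p s l * of_real (L (e l) x))"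
      by (simp add: algebra_simps)
    then show ?thesis
      by (simp add: Q_def E_def h_def exp_sum prod.distrib aff)
  qed
  have h_bi: "has_bochner_integral lborel (h s l) (Gamma (p s l) * z (e l) powr (- p s l))" if "l < k" for s l
    unfolding h_def using \<rho>[OF that] z[OF that] by (intro exp_Gamma_integral) auto
  have prod_h_int: "integrable ?M (\<lambda>y. \<Prod>l<k. h s l (y l))" for s
    using h_bi by (intro P.product_integrable_prod) (auto simp: has_bochner_integral_iff)
  have Q_int: "integrable ?M (Q s)" for s
    using integrable_PiM_affine_iff[OF _ det, of k "\<lambda>y. \<Prod>l<k. h s l (y l)" "\<lambda>_. 0"] prod_h_int[of s]
    by (simp add: Q_h[abs_def] A_def)
  have Q_integral: "(LINT x|?M. Q s x) = (\<Prod>l<k. Gamma (p s l) * z (e l) powr (- p s l)) / of_real \<bar>Determinant.det A\<bar>" for s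
  proof -
    have "(LINT x|?M. Q s x) = (LINT y|?M. (\<Prod>l<k. h s l (y l))) /\<^sub>R \<bar>Determinant.det A\<bar>"
      unfolding Q_h using prod_h_int[of s] by (intro integral_PiM_affine det) (auto simp: A_def)
    also have "(LINT y|?M. (\<Prod>l<k. h s l (y l))) = (\<Prod>l<k. integral\<^sup>L lborel (h s l))"
      using h_bi by (intro P.product_integral_prod) (auto simp: has_bochner_integral_iff)
    also have "\<dots> = (\<Prod>l<k. Gamma (p s l) * z (e l) powr (- p s l))"
      using h_bi by (intro prod.cong) (auto simp: has_bochner_integral_iff)
    finally show ?thesis by (simp add: scaleR_conv_of_real divide_inverse mult.commute)
  qed
  \<comment> \<open>Each factor \<open>h s l\<close> sees \<open>p s l\<close> in modulus only
    through \<open>\<rho> l\<close>; the contour point 0 is an arbitrary representative.\<close>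
  have norm_Q: "cmod (Q s x) = cmod (Q (\<lambda>_. 0) x)" for s x
    unfolding Q_h by (simp add: h_def norm_mult \<rho> flip: prod_norm)
  define H where "H = (\<lambda>x s. (\<Prod>\<kappa>\<in>K. g \<kappa> (s \<kappa>)) * Q s x)"
  have prod_g_int: "integrable ?N (\<lambda>s. \<Prod>\<kappa>\<in>K. g \<kappa> (s \<kappa>))"
    by (rule P.product_integrable_prod[OF K g_int])
  have H_meas: "(\<lambda>(x, s). H x s) \<in> borel_measurable (?M \<Otimes>\<^sub>M ?N)"
    unfolding H_def Q_def E_def t_def by measurable
  have norm_H: "cmod (H x s) = cmod (Q (\<lambda>_. 0) x) * cmod (\<Prod>\<kappa>\<in>K. g \<kappa> (s \<kappa>))" for x s
    unfolding H_def norm_mult norm_Q[of s] by (rule mult.commute)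
  have H_int: "integrable (?M \<Otimes>\<^sub>M ?N) (\<lambda>(x, s). H x s)"
  proof (rule MN.Fubini_integrable[OF H_meas])
    show "integrable ?M (\<lambda>x. LINT s|?N. norm (case (x, s) of (x, s) \<Rightarrow> H x s))"
      unfolding prod.case norm_H using Q_int[of "\<lambda>_. 0"] by simp
    show "AE x in ?M. integrable ?N (\<lambda>s. case (x, s) of (x, s) \<Rightarrow> H x s)"
    proof (rule AE_I2)
      fix x assume x: "x \<in> space ?M"
      have "integrable ?N (\<lambda>s. cmod (Q (\<lambda>_. 0) x) * cmod (\<Prod>\<kappa>\<in>K. g \<kappa> (s \<kappa>)))"
        using prod_g_int by simp
      moreover have "(\<lambda>s. H x s) \<in> borel_measurable ?N"
        using measurable_compose_Pair1[OF x H_meas] by simp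
      ultimately have "integrable ?N (H x)"
        by (rule Bochner_Integration.integrable_bound) (simp_all add: norm_H)
      then show "integrable ?N (\<lambda>s. case (x, s) of (x, s) \<Rightarrow> H x s)" by simp
    qed
  qed
  define C where "C = complex_of_real (2 * pi) ^ card K"
  have C0: "C \<noteq> 0" by (simp add: C_def)
  have H_s: "(LINT s|?N. H x s) = C * F x" for x
  proof -
    have "H x s = exp (\<Sum>i<k. \<nu> i * of_real (x i)) * E x * (\<Prod>\<kappa>\<in>K. g \<kappa> (s \<kappa>) * exp (- t \<kappa> (s \<kappa>) * of_real (L \<kappa> x)))" for s
    proof -
      have "(\<Sum>i<k. \<nu> i * of_real (x i)) - (\<Sum>\<kappa>\<in>K. t \<kappa> (s \<kappa>) * of_real (L \<kappa> x))
          = (\<Sum>i<k. \<nu> i * of_real (x i)) + (\<Sum>\<kappa>\<in>K. - t \<kappa> (s \<kappa>) * of_real (L \<kappa> x))"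
        by (simp add: sum_negf)
      then show ?thesis
        by (simp only: H_def Q_def exp_add exp_sum[OF K] prod.distrib mult_ac)
    qed
    then have "(LINT s|?N. H x s) = exp (\<Sum>i<k. \<nu> i * of_real (x i)) * E x * (LINT s|?N. (\<Prod>\<kappa>\<in>K. g \<kappa> (s \<kappa>) * exp (- t \<kappa> (s \<kappa>) * of_real (L \<kappa> x))))"
      by simp
    also have "(LINT s|?N. (\<Prod>\<kappa>\<in>K. g \<kappa> (s \<kappa>) * exp (- t \<kappa> (s \<kappa>) * of_real (L \<kappa> x))))
       = (\<Prod>\<kappa>\<in>K. (LINT y|lborel. g \<kappa> y * exp (- t \<kappa> y * of_real (L \<kappa> x))))"
    proof (rule P.product_integral_prod[OF K])
      fix \<kappa> assume \<kappa>: "\<kappa> \<in> K"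
      have "integrable lborel (\<lambda>y. exp (- c \<kappa> * L \<kappa> x) * cmod (g \<kappa> y))" using g_int[OF \<kappa>] by simp
      then show "integrable lborel (\<lambda>y. g \<kappa> y * exp (- t \<kappa> y * of_real (L \<kappa> x)))"
        by (rule Bochner_Integration.integrable_bound) (use \<kappa> in \<open>auto simp: t_def norm_mult intro!: borel_measurable_times\<close>)
    qed
    also have "\<dots> = (\<Prod>\<kappa>\<in>K. of_real (2 * pi) * exp (- z \<kappa> * of_real (exp (L \<kappa> x))))"
      by (rule prod.cong) (simp_all only: g_def t_def mellin_barnes_exp[OF c zK])
    finally show ?thesis by (simp add: F_def E_def C_def prod.distrib)
  qed
  \<comment> \<open>Integrating out the contour variables recovers \<open>F\<close> up to the
    constant \<open>C\<close>, so convergence of the lifted integral is a by-product of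
    Fubini.\<close>
  have "integrable ?M (\<lambda>x. LINT s|?N. H x s)"
    using MN.integrable_fst'[OF H_int] by simp
  then have "integrable ?M (\<lambda>x. inverse C * (C * F x))"
    unfolding H_s by (rule integrable_mult_right)
  then show ?int using C0 by (simp add: mult.assoc[symmetric])
  have "C * (LINT x|?M. F x) = (LINT x|?M. LINT s|?N. H x s)"
    unfolding H_s by simp
  also have "\<dots> = (LINT s|?N. LINT x|?M. H x s)"
    using MN.Fubini_integral[OF H_int] by simp
  also have "\<dots> = (LINT s|?N. ((\<Prod>\<kappa>\<in>K. g \<kappa> (s \<kappa>)) * (\<Prod>l<k. Gamma (p s l) * z (e l) powr (- p s l))) / of_real \<bar>Determinant.det A\<bar>)"
    unfolding H_def by (simp add: Q_integral)
  also have "\<dots> = (LINT s|?N. (\<Prod>\<kappa>\<in>K. g \<kappa> (s \<kappa>)) * (\<Prod>l<k. Gamma (p s l) * z (e l) powr (- p s l))) / of_real \<bar>Determinant.det A\<bar>"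
    by (rule integral_divide_zero)
  finally show ?eq
    unfolding g_def C_def[symmetric] using det C0 by (simp add: field_simps)
qed

section \<open>The linear system of the submatrix for \<sigma>\<close>

text \<open>\<open>sub_inv_apply\<close> addresses the entry of an index by the number of smaller
  elements of \<sigma>; this matches that count with the position in the sorted list.\<close>

lemma card_less_sorted_list_of_set_nth:
  fixes S :: "'a :: linorder set"
  assumes "finite S" "l < card S"
  shows "card {x \<in> S. x < sorted_list_of_set S ! l} = l"
proof -
  let ?xs = "sorted_list_of_set S"
  have len: "length ?xs = card S" and d: "distinct ?xs" and set: "set ?xs = S"
    using assms by simp_all
  have sorted: "?xs ! i < ?xs ! j" if "i < j" "j < card S" for i j
    using strict_sorted_list_of_set[of S] that len by (auto simp: sorted_wrt_iff_nth_less)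
  have "{x \<in> S. x < ?xs ! l} = (\<lambda>i. ?xs ! i) ` {..<l}"
  proof (intro equalityI subsetI)
    fix x assume x: "x \<in> {x \<in> S. x < ?xs ! l}"
    then obtain i where i: "i < card S" "x = ?xs ! i" using set len by (metis in_set_conv_nth mem_Collect_eq)
    have "i < l"
    proof (rule ccontr)
      assume "\<not> i < l"
      then have "i = l \<or> ?xs ! l < ?xs ! i" using sorted[of l i] i by linarith
      with x i show False by auto
    qed
    with i show "x \<in> (\<lambda>i. ?xs ! i) ` {..<l}" by auto
  next
    fix x assume "x \<in> (\<lambda>i. ?xs ! i) ` {..<l}"
    then obtain i where "i < l" "x = ?xs ! i" by auto
    then show "x \<in> {x \<in> S. x < ?xs ! l}"
      using sorted[of i l] assms nth_mem[of i ?xs] by (auto simp: set len)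
  qed
  moreover have "inj_on (\<lambda>i. ?xs ! i) {..<l}"
    using d assms(2) len by (auto simp: inj_on_def nth_eq_iff_index_eq)
  ultimately show ?thesis by (simp add: card_image)
qed

text \<open>These two facts replace the inverse matrix from here on: solvability produces the
  exponents \<open>p\<close>, and uniqueness identifies their real parts.\<close>

lemma
  fixes v x :: "nat \<Rightarrow> complex"
  assumes "finite \<sigma>" and card: "card \<sigma> = n + 1" and det: "Determinant.det (sub_mat n a \<sigma>) \<noteq> 0"
  defines "e \<equiv> \<lambda>l. sorted_list_of_set \<sigma> ! l"
  shows sub_inv_apply_solves: "i < n + 1 \<Longrightarrow> (\<Sum>l<n + 1. colA a (e l) i * sub_inv_apply n a \<sigma> v (e l)) = v i"
    and sub_inv_apply_unique: "(\<And>i. i < n + 1 \<Longrightarrow> (\<Sum>l<n + 1. colA a (e l) i * x l) = v i) \<Longrightarrow> l < n + 1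
      \<Longrightarrow> sub_inv_apply n a \<sigma> v (e l) = x l"
proof -
  let ?S = "sub_mat n a \<sigma>"
  have S: "?S \<in> carrier_mat (n + 1) (n + 1)" by (simp add: sub_mat_def card)
  obtain B where B: "mat_inverse ?S = Some B"
    using mat_inverse(1)[OF S, of undefined] det_non_zero_imp_unit[OF S det, of undefined] by (cases "mat_inverse ?S") auto
  then have SB: "?S * B = 1\<^sub>m (n + 1)" "B * ?S = 1\<^sub>m (n + 1)" "B \<in> carrier_mat (n + 1) (n + 1)"
    using mat_inverse(2)[OF S] by auto
  have app: "sub_inv_apply n a \<sigma> v (e l) = (B *\<^sub>v Matrix.vec (n + 1) v) $ l" if "l < n + 1" for l v
  proof -
    have "e l \<in> \<sigma>" using that assms(1) card nth_mem[of l "sorted_list_of_set \<sigma>"] by (auto simp: e_def)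
    then show ?thesis
      using that card_less_sorted_list_of_set_nth[OF assms(1), of l] card by (simp add: sub_inv_apply_def B e_def)
  qed
  have mult: "(?S *\<^sub>v Matrix.vec (n + 1) y) $ i = (\<Sum>l<n + 1. colA a (e l) i * y l)" if "i < n + 1" for y i
    using that card by (simp add: sub_mat_def e_def scalar_prod_def lessThan_atLeast0)
  show "(\<Sum>l<n + 1. colA a (e l) i * sub_inv_apply n a \<sigma> v (e l)) = v i" if i: "i < n + 1"
  proof -
    have "Matrix.vec (n + 1) (\<lambda>l. sub_inv_apply n a \<sigma> v (e l)) = B *\<^sub>v Matrix.vec (n + 1) v"
      using SB(3) by (intro eq_vecI) (auto simp: app)
    then have "?S *\<^sub>v Matrix.vec (n + 1) (\<lambda>l. sub_inv_apply n a \<sigma> v (e l)) = Matrix.vec (n + 1) v"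
      using SB S by (simp add: assoc_mult_mat_vec[symmetric, of _ "n + 1" "n + 1" _ "n + 1"])
    then show ?thesis using mult[OF i, of "\<lambda>l. sub_inv_apply n a \<sigma> v (e l)"] i by simp
  qed
  show "sub_inv_apply n a \<sigma> v (e l) = x l"
    if eq: "\<And>i. i < n + 1 \<Longrightarrow> (\<Sum>l<n + 1. colA a (e l) i * x l) = v i" and l: "l < n + 1"
  proof -
    have "?S *\<^sub>v Matrix.vec (n + 1) x = Matrix.vec (n + 1) v"
    proof (rule eq_vecI)
      fix i assume "i < dim_vec (Matrix.vec (n + 1) v)"
      then have i: "i < n + 1" by simp
      show "(?S *\<^sub>v Matrix.vec (n + 1) x) $ i = Matrix.vec (n + 1) v $ i"
        by (simp only: mult[OF i] eq[OF i] index_vec[OF i])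
    qed (use S in simp)
    then have "B *\<^sub>v Matrix.vec (n + 1) v = B *\<^sub>v (?S *\<^sub>v Matrix.vec (n + 1) x)" by simp
    also have "\<dots> = Matrix.vec (n + 1) x"
      using SB S by (simp add: assoc_mult_mat_vec[symmetric, of _ "n + 1" "n + 1" _ "n + 1"])
    finally show ?thesis using l by (simp add: app)
  qed
qed

section \<open>Identification of the Feynman integral with the lifted integral\<close>

theorem theorem2:
  fixes n N :: nat and a :: "nat \<Rightarrow> nat \<Rightarrow> nat" and z :: "nat \<Rightarrow> complex"
    and \<sigma> :: "nat set" and nu0 :: complex and nu :: "nat \<Rightarrow> complex" and c :: "nat \<Rightarrow> real"
  assumes n_pos: "1 \<le> n" and N_ge: "n + 1 \<le> N"
    and a_distinct: "\<forall>j<N. \<forall>k<N. j \<noteq> k \<longrightarrow> (\<exists>i<n. a j i \<noteq> a k i)"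
    and z_re: "\<forall>j<N. 0 < Re (z j)"
    and sigma_sub: "\<sigma> \<subseteq> {..<N}" and sigma_card: "card \<sigma> = n + 1"
    and det_nz: "Determinant.det (sub_mat n a \<sigma>) \<noteq> 0"
    and nu0_re: "0 < Re nu0"
    and c_pos: "\<forall>k\<in>{..<N} - \<sigma>. 0 < c k"
    and c_cond: "\<forall>j\<in>\<sigma>. 0 < Re (sub_inv_apply n a \<sigma> (\<lambda>i. complex_of_real (Re (nuvec nu0 nu i))) j
                               - sub_inv_apply n a \<sigma> (cols_apply a ({..<N} - \<sigma>) (\<lambda>k. complex_of_real (c k))) j)"
    and abs_conv: "integrable (PiM ({..<N} - \<sigma>) (\<lambda>_. lborel))
                     (\<lambda>s. MB_integrand n N a \<sigma> nu0 nu z (\<lambda>k. complex_of_real (c k) + \<i> * complex_of_real (s k)))"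
  shows "feynJ n N a nu0 nu z =
    (\<Prod>j\<in>\<sigma>. z j powr (- sub_inv_apply n a \<sigma> (nuvec nu0 nu) j))
      / complex_of_real (cmod (Determinant.det (sub_mat n a \<sigma>)))
    * ((1 / (2 * complex_of_real pi * \<i>) ^ (N - n - 1)) * (\<i> ^ (N - n - 1) *
        (LINT s | PiM ({..<N} - \<sigma>) (\<lambda>_. lborel).
           MB_integrand n N a \<sigma> nu0 nu z (\<lambda>k. complex_of_real (c k) + \<i> * complex_of_real (s k)))))"
proof -
  define K where "K = {..<N} - \<sigma>"
  define e where "e = (\<lambda>l. sorted_list_of_set \<sigma> ! l)"
  define \<alpha> where "\<alpha> = (\<lambda>j i. if i = 0 then 1 else real (a j (i - 1)))"
  define A where "A = Matrix.mat (Suc n) (Suc n) (\<lambda>(l, i). \<alpha> (e l) i)"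
  have fin: "finite \<sigma>" using sigma_sub finite_subset by blast
  have K: "finite K" by (simp add: K_def)
  have card_K: "card K = N - n - 1"
    using sigma_sub sigma_card fin by (simp add: K_def card_Diff_subset)
  have e_bij: "bij_betw e {..<Suc n} \<sigma>"
    unfolding e_def using sigma_card fin by (intro bij_betw_nth) auto
  have e_mem: "e l \<in> \<sigma>" if "l < Suc n" for l
    using bij_betw_apply[OF e_bij] that by simp
  have z_e: "0 < Re (z (e l))" if "l < Suc n" for l
    using e_mem[OF that] sigma_sub z_re by blast
  have z_K: "0 < Re (z \<kappa>)" and c_K: "0 < c \<kappa>" if "\<kappa> \<in> K" for \<kappa>
    using that z_re c_pos by (auto simp: K_def)
  have colA_\<alpha>: "colA a j i = of_real (\<alpha> j i)" for j i
    by (simp add: colA_def \<alpha>_def)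
  \<comment> \<open>The rows of \<open>A\<close> are the columns indexed by \<sigma>, because the
    new coordinates are pairings with these columns. Transposition preserves the determinant, and
    real entries make its modulus \<open>|det A|\<close>.\<close>
  have sub_mat_A: "sub_mat n a \<sigma> = transpose_mat (map_mat of_real A)"
    by (rule eq_matI) (auto simp: sub_mat_def A_def sigma_card colA_\<alpha> e_def)
  have det_A: "Determinant.det (sub_mat n a \<sigma>) = of_real (Determinant.det A)"
    unfolding sub_mat_A by (subst det_transpose[of _ "Suc n"]) (auto simp: A_def of_real_hom.hom_det)
  define t where "t = (\<lambda>\<kappa> y. complex_of_real (c \<kappa>) + \<i> * of_real y)"
  define w where "w = sub_inv_apply n a \<sigma> (nuvec nu0 nu)"
  define u where "u = (\<lambda>s. sub_inv_apply n a \<sigma> (cols_apply a K (\<lambda>\<kappa>. t \<kappa> (s \<kappa>))))"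
  define p where "p = (\<lambda>s l. w (e l) - u s (e l))"
  define \<rho> where "\<rho> = (\<lambda>l. Re (sub_inv_apply n a \<sigma> (\<lambda>i. complex_of_real (Re (nuvec nu0 nu i))) (e l)
      - sub_inv_apply n a \<sigma> (cols_apply a K (\<lambda>k. complex_of_real (c k))) (e l)))"
  note solves = sub_inv_apply_solves[OF fin sigma_card det_nz, folded e_def, unfolded Suc_eq_plus1[symmetric]]
  note unique = sub_inv_apply_unique[OF fin sigma_card det_nz, folded e_def, unfolded Suc_eq_plus1[symmetric]]
  have p_solves: "(\<Sum>l<Suc n. p s l * of_real (\<alpha> (e l) i)) + (\<Sum>\<kappa>\<in>K. t \<kappa> (s \<kappa>) * of_real (\<alpha> \<kappa> i)) = nuvec nu0 nu i"
    if i: "i < Suc n" for s i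
  proof -
    have "(\<Sum>l<Suc n. p s l * of_real (\<alpha> (e l) i)) = (\<Sum>l<Suc n. colA a (e l) i * w (e l)) - (\<Sum>l<Suc n. colA a (e l) i * u s (e l))"
      by (simp add: p_def colA_\<alpha> algebra_simps sum_subtractf del: sum.lessThan_Suc)
    also have "\<dots> = nuvec nu0 nu i - cols_apply a K (\<lambda>\<kappa>. t \<kappa> (s \<kappa>)) i"
      unfolding w_def u_def solves[OF i] ..
    finally show ?thesis by (simp add: cols_apply_def colA_\<alpha> mult.commute)
  qed
  \<comment> \<open>As \<open>A\<^sub>\<sigma>\<close> is real, \<open>Re p\<close> solves the real part of the system, so it does not depend on the position on the contour.\<close>
  have Re_p: "Re (p s l) = \<rho> l" if l: "l < Suc n" for s l
  proof -
    let ?v = "\<lambda>i. complex_of_real (Re (nuvec nu0 nu i))" and ?c = "cols_apply a K (\<lambda>k. complex_of_real (c k))"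
    have "sub_inv_apply n a \<sigma> ?v (e l) = sub_inv_apply n a \<sigma> ?c (e l) + of_real (Re (p s l))"
    proof (rule unique[OF _ l])
      fix i assume i: "i < Suc n"
      have "Re (nuvec nu0 nu i) = (\<Sum>l<Suc n. Re (p s l) * \<alpha> (e l) i) + (\<Sum>\<kappa>\<in>K. c \<kappa> * \<alpha> \<kappa> i)"
        unfolding p_solves[OF i, of s, symmetric] by (simp add: t_def del: sum.lessThan_Suc)
      then have "(\<Sum>l<Suc n. colA a (e l) i * of_real (Re (p s l))) = ?v i - ?c i"
        by (simp add: colA_\<alpha> cols_apply_def mult.commute del: sum.lessThan_Suc)
      then show "(\<Sum>l<Suc n. colA a (e l) i * (sub_inv_apply n a \<sigma> ?c (e l) + of_real (Re (p s l)))) = ?v i"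
        by (simp add: distrib_left sum.distrib solves[OF i] del: sum.lessThan_Suc)
    qed
    then show ?thesis by (simp add: \<rho>_def)
  qed
  have \<rho>_pos: "0 < \<rho> l" if "l < Suc n" for l
    using c_cond e_mem[OF that] unfolding \<rho>_def K_def by blast
  define L where "L = (\<lambda>j (x :: nat \<Rightarrow> real). \<Sum>i<Suc n. \<alpha> j i * x i)"
  define F where "F = (\<lambda>x. exp (\<Sum>i<Suc n. nuvec nu0 nu i * of_real (x i)) * (\<Prod>l<Suc n. exp (- z (e l) * of_real (exp (L (e l) x))))
      * (\<Prod>\<kappa>\<in>K. exp (- z \<kappa> * of_real (exp (L \<kappa> x)))))"
  have detA0: "Determinant.det A \<noteq> 0" using det_nz det_A by auto
  have F_int: "integrable (PiM {..<Suc n} (\<lambda>_. lborel)) F"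
    and F_eq: "(LINT x|PiM {..<Suc n} (\<lambda>_. lborel). F x) = (LINT s|PiM K (\<lambda>_. lborel).
          (\<Prod>\<kappa>\<in>K. Gamma (t \<kappa> (s \<kappa>)) * z \<kappa> powr (- t \<kappa> (s \<kappa>))) * (\<Prod>l<Suc n. Gamma (p s l) * z (e l) powr (- p s l)))
          / (of_real (2 * pi) ^ card K * of_real \<bar>Determinant.det A\<bar>)"
    unfolding F_def L_def t_def A_def
    using mellin_barnes_change_of_variables[where \<rho> = \<rho> and c = c and z = z, OF K detA0[unfolded A_def] z_e z_K c_K p_solves[unfolded t_def] Re_p \<rho>_pos]
    by (simp_all only:)
  define G where "G = (\<lambda>x. \<Sum>j<N. z j * of_real (exp (\<Sum>i<n. real (a j i) * x i)))"
  \<comment> \<open>The sum is nonempty since \<open>N\<close> is at least \<open>n + 1\<close>. A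
    positive real part allows the Mellin integral to produce the principal branch of
    \<open>G x powr (- nu0)\<close>.\<close>
  have G_pos: "0 < Re (G x)" for x
    unfolding G_def Re_sum using N_ge z_re by (intro sum_pos) (auto simp: lessThan_empty_iff bot_nat_def)
  \<comment> \<open>The row of ones contributes the same \<open>y\<close> to every
    \<open>L j\<close>, so the factors from \<sigma> and from \<open>K\<close> merge into the single
    exponential of \<open>- G x * exp y\<close>.\<close>
  have F_cons: "F (seq_cons n x y) = exp (\<Sum>i<n. nu i * of_real (x i)) * (exp (nu0 * of_real y) * exp (- G x * of_real (exp y)))" for x y
  proof -
    have "L j (seq_cons n x y) = y + (\<Sum>i<n. real (a j i) * x i)" for j
      by (simp add: L_def \<alpha>_def seq_cons_def sum.lessThan_Suc_shift del: sum.lessThan_Suc)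
    moreover have "(\<Sum>i<Suc n. nuvec nu0 nu i * of_real (seq_cons n x y i)) = nu0 * of_real y + (\<Sum>i<n. nu i * of_real (x i))"
      by (simp add: nuvec_def seq_cons_def sum.lessThan_Suc_shift del: sum.lessThan_Suc)
    moreover define f where "f = (\<lambda>j. exp (- z j * of_real (exp (y + (\<Sum>i<n. real (a j i) * x i)))))"
    have "(\<Prod>l<Suc n. f (e l)) * (\<Prod>\<kappa>\<in>K. f \<kappa>) = (\<Prod>j<N. f j)"
      using prod.reindex_bij_betw[OF e_bij, of f] prod.subset_diff[OF sigma_sub, of f]
      by (simp add: K_def mult.commute del: prod.lessThan_Suc)
    ultimately have "F (seq_cons n x y) = exp (nu0 * of_real y + (\<Sum>i<n. nu i * of_real (x i)))
        * (\<Prod>j<N. exp (- z j * of_real (exp (y + (\<Sum>i<n. real (a j i) * x i)))))"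
      unfolding F_def f_def by (simp only: mult.assoc)
    also have "(\<Prod>j<N. exp (- z j * of_real (exp (y + (\<Sum>i<n. real (a j i) * x i))))) = exp (- G x * of_real (exp y))"
      by (simp add: G_def exp_add sum_distrib_left sum_distrib_right sum_negf mult_ac flip: exp_sum)
    finally show ?thesis by (simp add: exp_add mult_ac)
  qed
  have "feynJ n N a nu0 nu z = (LINT x|PiM {..<n} (\<lambda>_. lborel). (LINT y|lborel. F (seq_cons n x y)))"
  proof -
    define f where "f = (\<lambda>x. (\<Prod>i<n. complex_of_real (x i) powr (nu i - 1)) * Gpoly n N a z x powr (- nu0))"
    have f: "f \<in> borel_measurable (PiM {..<n} (\<lambda>_. lborel))"
      unfolding f_def Gpoly_def powr_def by measurable
    have "feynJ n N a nu0 nu z = Gamma nu0 * (LINT x|PiM {..<n} (\<lambda>_. lborel). (\<Prod>i<n. exp (x i)) *\<^sub>R f (\<lambda>i\<in>{..<n}. exp (x i)))"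
      using integral_PiM_exp_substitution[OF _ f] by (simp add: feynJ_def f_def Ball_def)
    also have "\<dots> = (LINT x|PiM {..<n} (\<lambda>_. lborel). Gamma nu0 * ((\<Prod>i<n. exp (x i)) *\<^sub>R f (\<lambda>i\<in>{..<n}. exp (x i))))"
      by (rule integral_mult_right_zero[symmetric])
    also have "\<dots> = (LINT x|PiM {..<n} (\<lambda>_. lborel). (LINT y|lborel. F (seq_cons n x y)))"
    proof (rule Bochner_Integration.integral_cong)
      fix x :: "nat \<Rightarrow> real"
      \<comment> \<open>The Jacobian of \<open>exp\<close> absorbs the shift by 1 in the exponents
        \<open>nu i - 1\<close>.\<close>
      have "complex_of_real (\<Prod>i<n. exp (x i)) * (\<Prod>i<n. complex_of_real (exp (x i)) powr (nu i - 1)) = exp (\<Sum>i<n. nu i * of_real (x i))"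
      proof -
        have "complex_of_real (exp (x i)) * complex_of_real (exp (x i)) powr (nu i - 1) = exp (nu i * of_real (x i))" for i
          by (simp add: powr_def Ln_of_real ring_distribs exp_diff flip: exp_of_real)
        then show ?thesis by (simp add: exp_sum flip: prod.distrib)
      qed
      moreover have "Gpoly n N a z (\<lambda>i\<in>{..<n}. exp (x i)) = G x"
        by (simp add: Gpoly_def G_def exp_sum exp_of_nat_mult)
      ultimately have "Gamma nu0 * ((\<Prod>i<n. exp (x i)) *\<^sub>R f (\<lambda>i\<in>{..<n}. exp (x i)))
          = exp (\<Sum>i<n. nu i * of_real (x i)) * (Gamma nu0 * G x powr (- nu0))"
        by (simp add: f_def scaleR_conv_of_real mult_ac)
      also have "Gamma nu0 * G x powr (- nu0) = (LINT y|lborel. exp (nu0 * of_real y) * exp (- G x * of_real (exp y)))"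
        using exp_Gamma_integral[OF nu0_re G_pos, of x] by (simp add: has_bochner_integral_iff)
      finally show "Gamma nu0 * ((\<Prod>i<n. exp (x i)) *\<^sub>R f (\<lambda>i\<in>{..<n}. exp (x i))) = (LINT y|lborel. F (seq_cons n x y))"
        unfolding F_cons by (simp only: integral_mult_right_zero)
    qed simp
    finally show ?thesis .
  qed
  also have "\<dots> = (LINT x|PiM {..<Suc n} (\<lambda>_. lborel). F x)"
    by (rule integral_seq_cons[OF F_int, symmetric])
  also have "\<dots> = (LINT s|PiM K (\<lambda>_. lborel). (\<Prod>j\<in>\<sigma>. z j powr (- w j)) * MB_integrand n N a \<sigma> nu0 nu z (\<lambda>\<kappa>. t \<kappa> (s \<kappa>)))
      / (of_real (2 * pi) ^ card K * of_real \<bar>Determinant.det A\<bar>)"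
  proof -
    have "(\<Prod>\<kappa>\<in>K. Gamma (t \<kappa> (s \<kappa>)) * z \<kappa> powr (- t \<kappa> (s \<kappa>))) * (\<Prod>l<Suc n. Gamma (p s l) * z (e l) powr (- p s l))
        = (\<Prod>j\<in>\<sigma>. z j powr (- w j)) * MB_integrand n N a \<sigma> nu0 nu z (\<lambda>\<kappa>. t \<kappa> (s \<kappa>))" for s
    proof -
      have "(\<Prod>l<Suc n. Gamma (p s l) * z (e l) powr (- p s l)) = (\<Prod>j\<in>\<sigma>. Gamma (w j - u s j) * z j powr (- (w j - u s j)))"
        unfolding p_def by (rule prod.reindex_bij_betw[OF e_bij])
      also have "\<dots> = (\<Prod>j\<in>\<sigma>. Gamma (w j - u s j) * (z j powr (- w j) * z j powr (u s j)))"
        by (rule prod.cong) (simp_all flip: powr_add)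
      finally show ?thesis
        by (simp only: MB_integrand_def Let_def prod.distrib w_def[symmetric] K_def[symmetric] u_def mult_ac)
    qed
    then show ?thesis unfolding F_eq by (simp only:)
  qed
  also have "\<dots> = (\<Prod>j\<in>\<sigma>. z j powr (- w j)) * (LINT s|PiM K (\<lambda>_. lborel). MB_integrand n N a \<sigma> nu0 nu z (\<lambda>\<kappa>. t \<kappa> (s \<kappa>)))
      / (of_real (2 * pi) ^ card K * of_real \<bar>Determinant.det A\<bar>)"
    by simp
  \<comment> \<open>With \<open>r = card K\<close>, the factor \<open>\<i> ^ r\<close> from
    \<open>dt = \<i> ds\<close> cancels against \<open>(2 * pi * \<i>) ^ r\<close>, leaving the
    power of \<open>2 * pi\<close> that came from the Mellin-Barnes factors.\<close>
  finally show ?thesis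
    unfolding det_A norm_of_real card_K[symmetric] K_def[symmetric] w_def[symmetric]
    by (simp add: power_mult_distrib t_def mult.commute)
qed

end
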